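(* Let $1\le n\le N$, $q=N-n$ and $r=\min(n,q)$. Let $A$ be a positive definite Hermitian $N\times N$ complex matrix, written in blocks as $$A=\begin{pmatrix} A_{11} & A_{12} \\ A_{12}^{\star} & A_{22} \end{pmatrix},\qquad A_{11}\in\mathbb{C}^{n\times n},\ A_{12}\in\mathbb{C}^{n\times q},\ A_{22}\in\mathbb{C}^{q\times q},$$ and set $R:=A_{11}^{-1/2}A_{12}A_{22}^{-1/2}\in\mathbb{C}^{n\times q}$. Then: (i) the $n\times n$ matrix $\pi_n(A)\pi_n(A^{-1})$ has at least $n-r=(2n-N)_+$ eigenvalues equal to one; (ii) its remaining $r$ eigenvalues are $$\frac{1}{1-s_1(R)^2},\ \ldots,\ \frac{1}{1-s_r(R)^2},$$ where $s_1(R),\ldots,s_r(R)$ are the (possibly nonzero) singular values of $R$; (iii) the eigenvalues of $\pi_n(A)\pi_n(A^{-1})$ different from one coincide, with multiplicities, with the eigenvalues different from one of the complementary product $A_{22}\,(A^{-1})_{22}$, where $(A^{-1})_{22}$ is the lower-right $q\times q$ block of $A^{-1}$; (iv) if $R$ has full rank, the multiplicity of the eigenvalue one of $\pi_n(A)\pi_n(A^{-1})$ is exactly $(2n-N)_+$.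
   Context: For an $N\times N$ matrix $A$, $\pi_n(A)$ denotes its upper-left $n\times n$ corner, so $\pi_n(A)=A_{11}$. $(x)_+=\max(x,0)$. When $q=0$ the blocks with a zero dimension are empty. All singular values of $R$ are strictly smaller than one. *)

theory Defs
  imports
    "Jordan_Normal_Form.Schur_Decomposition"
    "Jordan_Normal_Form.Gauss_Jordan_Elimination"
    "Jordan_Normal_Form.DL_Rank"
begin

definition hermitian_mat :: "complex mat \<Rightarrow> bool" where
  "hermitian_mat A \<longleftrightarrow> mat_adjoint A = A"

definition pos_def_mat :: "complex mat \<Rightarrow> bool" where
  "pos_def_mat A \<longleftrightarrow> hermitian_mat A \<and>
     (\<forall>v \<in> carrier_vec (dim_row A). v \<noteq> 0\<^sub>v (dim_row A) \<longrightarrow> Re ((A *\<^sub>v v) \<bullet>c v) > 0)"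

text \<open>Only meaningful for invertible matrices, where the option value is not \<open>None\<close>.\<close>

definition mat_inv :: "complex mat \<Rightarrow> complex mat" where
  "mat_inv A = the (mat_inverse A)"

text \<open>Only meaningful for positive definite \<open>A\<close>, where such a \<open>B\<close> exists and is unique.\<close>

definition pd_sqrt :: "complex mat \<Rightarrow> complex mat" where
  "pd_sqrt A = (THE B. B \<in> carrier_mat (dim_row A) (dim_row A) \<and> pos_def_mat B \<and> B * B = A)"

definition pd_inv_sqrt :: "complex mat \<Rightarrow> complex mat" where
  "pd_inv_sqrt A = mat_inv (pd_sqrt A)"

definition upper_left :: "nat \<Rightarrow> 'a mat \<Rightarrow> 'a mat" where
  "upper_left n A = mat n n (\<lambda>(i, j). A $$ (i, j))"

definition lower_right :: "nat \<Rightarrow> 'a mat \<Rightarrow> 'a mat" where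
  "lower_right q A = mat q q (\<lambda>(i, j). A $$ (dim_row A - q + i, dim_col A - q + j))"

text \<open>Eigenvalues with their algebraic multiplicities.\<close>

definition eigenvalues_mset :: "complex mat \<Rightarrow> complex multiset" where
  "eigenvalues_mset A = proots (char_poly A)"

text \<open>
  The \<open>i\<close>-th largest singular value, counted from \<open>i = 1\<close>: the square root of the \<open>i\<close>-th largest
  eigenvalue of \<open>M\<^sup>*M\<close>. That matrix is Hermitian, so taking real parts only changes the type.
  For an \<open>m \<times> k\<close> matrix the value is unspecified unless \<open>1 \<le> i \<le> k\<close>; the usual range is
  \<open>1 \<le> i \<le> min m k\<close>.
\<close>

definition singular_value :: "complex mat \<Rightarrow> nat \<Rightarrow> real" where
  "singular_value M i =
     sqrt (rev (sorted_list_of_multiset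
                  (image_mset Re (eigenvalues_mset (mat_adjoint M * M)))) ! (i - 1))"

definition full_rank :: "complex mat \<Rightarrow> bool" where
  "full_rank M \<longleftrightarrow> vec_space.rank (dim_row M) M = min (dim_row M) (dim_col M)"

end

theory Submission
  imports Defs
begin

text \<open>
  Whitening the diagonal blocks gives \<open>A = diag(A\<^sub>1\<^sub>1\<^sup>1\<^sup>/\<^sup>2, A\<^sub>2\<^sub>2\<^sup>1\<^sup>/\<^sup>2) [[1, R], [R\<^sup>*, 1]] diag(A\<^sub>1\<^sub>1\<^sup>1\<^sup>/\<^sup>2, A\<^sub>2\<^sub>2\<^sup>1\<^sup>/\<^sup>2)\<close>.
  The diagonal blocks of the inverse of the middle factor are \<open>(1 - R R\<^sup>*)\<^sup>-\<^sup>1\<close> and \<open>(1 - R\<^sup>* R)\<^sup>-\<^sup>1\<close>,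
  so \<open>\<pi>\<^sub>n(A) \<pi>\<^sub>n(A\<^sup>-\<^sup>1)\<close> and the complementary product are similar to these two matrices.
  The spectra of \<open>R R\<^sup>*\<close> and \<open>R\<^sup>* R\<close> differ only in the multiplicity of zero, and positive
  definiteness of the Schur complement \<open>1 - R\<^sup>* R\<close> puts the singular values of \<open>R\<close> below one.
\<close>

text \<open>Two encodings shape the proof. \<open>pd_sqrt\<close> is a definite description, so
  nothing can be said about \<open>R\<close> before existence and uniqueness of the root are known;
  both rest on diagonalising Hermitian matrices. \<open>singular_value\<close> reads the sorted
  spectrum of \<open>mat_adjoint R * R\<close>, of size q, while the corner product is governed by
  \<open>R * mat_adjoint R\<close>, of size n. For q > n the sorted list is longer than the spectrum
  wanted. Its surplus entries are zeros, and since no entry is negative they come last in descending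
  order, so the first r entries are the right ones. Invertibility is available from positive
  definiteness only for the q x q resolvent; the n x n one is written explicitly in terms of
  it.\<close>

section \<open>Adjoints and products of matrices\<close>

lemma mat_adjoint_carrier [simp]:
  "A \<in> carrier_mat m k \<Longrightarrow> mat_adjoint A \<in> carrier_mat k m"
  by (simp add: mat_adjoint_def mat_of_rows_def)

lemma dim_mat_adjoint [simp]:
  "dim_row (mat_adjoint A) = dim_col A" "dim_col (mat_adjoint A) = dim_row A"
  by (auto simp: mat_adjoint_def mat_of_rows_def)

lemma index_mat_adjoint [simp]:
  fixes A :: "'a :: conjugatable_field mat"
  assumes "i < dim_col A" "j < dim_row A"
  shows "mat_adjoint A $$ (i, j) = conjugate (A $$ (j, i))"
  using assms by (simp add: mat_adjoint_def mat_of_rows_index)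

lemma mat_adjoint_adjoint [simp]:
  fixes A :: "'a :: conjugatable_field mat"
  shows "mat_adjoint (mat_adjoint A) = A"
  by (rule eq_matI) auto

lemma mat_adjoint_mult:
  fixes A B :: "'a :: conjugatable_field mat"
  assumes "A \<in> carrier_mat m k" "B \<in> carrier_mat k l"
  shows "mat_adjoint (A * B) = mat_adjoint B * mat_adjoint A"
proof (rule eq_matI)
  fix i j assume "i < dim_row (mat_adjoint B * mat_adjoint A)" "j < dim_col (mat_adjoint B * mat_adjoint A)"
  then have i: "i < l" and j: "j < m" using assms by auto
  then show "mat_adjoint (A * B) $$ (i, j) = (mat_adjoint B * mat_adjoint A) $$ (i, j)"
    using assms
    by (simp add: scalar_prod_def sum_conjugate conjugate_dist_mul mult.commute)
qed (use assms in auto)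

lemma mat_adjoint_one [simp]: "mat_adjoint (1\<^sub>m n) = (1\<^sub>m n :: complex mat)"
  by (rule eq_matI) (auto simp: conjugate_complex_def)

lemma mat_adjoint_minus:
  fixes A B :: "'a :: conjugatable_field mat"
  assumes "A \<in> carrier_mat m k" "B \<in> carrier_mat m k"
  shows "mat_adjoint (A - B) = mat_adjoint A - mat_adjoint B"
proof -
  have "conjugate (x - y) = conjugate x - conjugate y" for x y :: 'a
    by (metis conjugate_dist_add conjugate_neg diff_conv_add_uminus)
  then show ?thesis
    by (intro eq_matI) (use assms in auto)
qed

lemma mat_adjoint_four_block_mat:
  fixes A :: "'a :: conjugatable_field mat"
  assumes "A \<in> carrier_mat m k" "B \<in> carrier_mat m k'" "C \<in> carrier_mat m' k" "D \<in> carrier_mat m' k'"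
  shows "mat_adjoint (four_block_mat A B C D) =
    four_block_mat (mat_adjoint A) (mat_adjoint C) (mat_adjoint B) (mat_adjoint D)"
  by (rule eq_matI) (use assms in auto)

lemma mat_adjoint_scalar_prod:
  fixes A :: "'a :: conjugatable_field mat"
  assumes A: "A \<in> carrier_mat m k" and v: "v \<in> carrier_vec k" and w: "w \<in> carrier_vec m"
  shows "(A *\<^sub>v v) \<bullet>c w = v \<bullet>c (mat_adjoint A *\<^sub>v w)"
proof -
  have "(A *\<^sub>v v) \<bullet>c w = (\<Sum>i = 0..<m. \<Sum>j = 0..<k. A $$ (i, j) * v $ j * conjugate (w $ i))"
    using assms by (simp add: scalar_prod_def sum_distrib_right)
  also have "\<dots> = (\<Sum>j = 0..<k. \<Sum>i = 0..<m. A $$ (i, j) * v $ j * conjugate (w $ i))"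
    by (rule sum.swap)
  also have "\<dots> = v \<bullet>c (mat_adjoint A *\<^sub>v w)"
    using assms
    by (auto simp: scalar_prod_def sum_distrib_left sum_conjugate conjugate_dist_mul mult_ac intro!: sum.cong)
  finally show ?thesis .
qed

lemma mat_adjoint_mult_self_index:
  fixes W :: "'a :: conjugatable_field mat"
  assumes "W \<in> carrier_mat m k" "i < k" "j < k"
  shows "(mat_adjoint W * W) $$ (i, j) = col W j \<bullet>c col W i"
  using assms by (auto simp: scalar_prod_def mult.commute)

lemma mat_adjoint_mat_diag_of_real:
  "mat_adjoint (mat_diag n (\<lambda>i. complex_of_real (d i))) = mat_diag n (\<lambda>i. complex_of_real (d i))"
  by (rule eq_matI) (auto simp: mat_diag_def)

lemma mult_mat_inverse_cancel:
  fixes A :: "'a :: semiring_1 mat"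
  assumes "A * B = 1\<^sub>m n" "A \<in> carrier_mat n m" "B \<in> carrier_mat m n" "X \<in> carrier_mat n k"
  shows "A * (B * X) = X"
proof -
  have "A * (B * X) = A * B * X"
    using assms by (intro assoc_mult_mat[symmetric]) auto
  then show ?thesis using assms by simp
qed

text \<open>The bracketing that occurs when a matrix is conjugated by a product of two unitaries, as
  in the induction for the spectral theorem.\<close>

lemma mult_mat_regroup5:
  fixes A B C D E :: "'a :: semiring_0 mat"
  assumes "A \<in> carrier_mat n n" "B \<in> carrier_mat n n" "C \<in> carrier_mat n n"
    "D \<in> carrier_mat n n" "E \<in> carrier_mat n n"
  shows "A * B * C * (D * E) = A * (B * C * D) * E"
  using assms by (simp add: assoc_mult_mat[of _ n n _ n _ n])

lemma hermitian_matD: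
  assumes "hermitian_mat A" "A \<in> carrier_mat n n" "i < n" "j < n"
  shows "A $$ (i, j) = cnj (A $$ (j, i))"
proof -
  have "A $$ (i, j) = mat_adjoint A $$ (i, j)" using assms(1) by (simp add: hermitian_mat_def)
  then show ?thesis using assms(2-) by simp
qed

lemma hermitian_mat_congruence:
  assumes "hermitian_mat H" "H \<in> carrier_mat n n" "W \<in> carrier_mat n k"
  shows "hermitian_mat (mat_adjoint W * H * W)"
proof -
  have "mat_adjoint (mat_adjoint W * H * W) = mat_adjoint W * (mat_adjoint H * W)"
    using assms mult_carrier_mat[OF mat_adjoint_carrier[OF assms(3)] assms(2)]
    by (simp add: mat_adjoint_mult[of _ k n _ k] mat_adjoint_mult[of _ k n _ n])
  also have "\<dots> = mat_adjoint W * H * W"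
    using assms by (simp add: hermitian_mat_def assoc_mult_mat[of _ k n _ n _ k])
  finally show ?thesis by (simp add: hermitian_mat_def)
qed

section \<open>The spectral theorem for Hermitian matrices\<close>

text \<open>Gram-Schmidt keeps the first vector of a basis, so it is applied to a basis that starts
  with \<open>v\<close>. Its output is orthogonal but not normalised; dividing by the norms
  \<open>s\<close> makes it unitary and leaves the scalar \<open>c\<close>, which is harmless
  because only the direction of an eigenvector matters.\<close>

lemma exists_unitary_first_col:
  fixes v :: "complex vec"
  assumes v: "v \<in> carrier_vec n" and v0: "v \<noteq> 0\<^sub>v n"
  obtains W c where "W \<in> carrier_mat n n" "mat_adjoint W * W = 1\<^sub>m n"
    "col W 0 = c \<cdot>\<^sub>v v" "c \<noteq> 0"
proof -
  interpret cof_vec_space n "TYPE(complex)" .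
  define b where "b = basis_completion v"
  define ws where "ws = gram_schmidt n b"
  have n: "n \<noteq> 0" using v v0 by (metis eq_vecI carrier_vecD index_zero_vec(2) less_nat_zero_code)
  note bc = basis_completion[OF v v0, folded b_def]
  from bc(6,7) n obtain vs where bv: "b = v # vs" by (cases b) auto
  from gram_schmidt_result[OF bc(2) bc(4) bc(5) ws_def] 
  have ws: "set ws \<subseteq> carrier_vec n" "corthogonal ws" "length ws = n"
    using bc(6) by auto
  have hd: "hd ws = v" using gram_schmidt_hd[OF v, of vs] by (simp add: ws_def bv)
  define s where "s i = sqrt (Re ((ws ! i) \<bullet>c (ws ! i)))" for i
  define W where "W = mat n n (\<lambda>(i, j). ws ! j $ i / complex_of_real (s j))"
  have wsc: "ws ! i \<in> carrier_vec n" if "i < n" for i using ws that by auto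
  have ss: "complex_of_real (s i) * complex_of_real (s i) = (ws ! i) \<bullet>c (ws ! i) \<and> s i \<noteq> 0" if "i < n" for i
  proof -
    have "ws ! i \<bullet>c ws ! i \<noteq> 0"
      using corthogonalD[OF ws(2), of i i] that ws(3) by auto
    \<comment> \<open>The order on complex numbers requires equal imaginary parts, so this
      inequality also says that the value is real.\<close>
    moreover have "ws ! i \<bullet>c ws ! i \<ge> 0" by auto
    ultimately have "Re (ws ! i \<bullet>c ws ! i) > 0 \<and> ws ! i \<bullet>c ws ! i = complex_of_real (Re (ws ! i \<bullet>c ws ! i))"
      by (auto simp: less_eq_complex_def complex_eq_iff)
    then show ?thesis
      unfolding s_def by (metis less_eq_real_def of_real_mult real_sqrt_eq_zero_cancel_iff real_sqrt_mult_self abs_of_pos less_irrefl)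
  qed
  have Wc: "W \<in> carrier_mat n n" by (simp add: W_def)
  have colW: "col W j = (1 / complex_of_real (s j)) \<cdot>\<^sub>v ws ! j" if "j < n" for j
    using that wsc[OF that] by (intro eq_vecI) (auto simp: W_def)
  have "mat_adjoint W * W = 1\<^sub>m n"
  proof (rule eq_matI)
    fix i j assume "i < dim_row (1\<^sub>m n :: complex mat)" "j < dim_col (1\<^sub>m n :: complex mat)"
    then have i: "i < n" and j: "j < n" by auto
    have "(mat_adjoint W * W) $$ (i, j) = (ws ! j \<bullet>c ws ! i) / (complex_of_real (s j) * complex_of_real (s i))"
      using wsc[OF i] wsc[OF j]
      by (simp add: mat_adjoint_mult_self_index[OF Wc i j] colW i j conjugate_smult_vec)
    also have "\<dots> = 1\<^sub>m n $$ (i, j)"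
      using ss[OF i] ss[OF j] corthogonalD[OF ws(2), of j i] i j ws(3) by auto
    finally show "(mat_adjoint W * W) $$ (i, j) = 1\<^sub>m n $$ (i, j)" .
  qed (use Wc in auto)
  moreover have "ws ! 0 = v" using hd ws(3) n by (metis hd_conv_nth list.size(3))
  ultimately show ?thesis
    using that[of W "1 / complex_of_real (s 0)"] Wc colW[of 0] ss[of 0] n by auto
qed

text \<open>Deflation: with an eigenvector as first column of a unitary \<open>W\<close>, the first
  column of the conjugated matrix is \<open>e\<close> times a unit vector. Hermitian symmetry clears
  the first row as well and makes \<open>e\<close> real, so a Hermitian block of size
  \<open>n\<close> remains for the induction hypothesis.\<close>

theorem hermitian_spectral:
  assumes "H \<in> carrier_mat n n" "hermitian_mat H"
  shows "\<exists>U d. U \<in> carrier_mat n n \<and> mat_adjoint U * U = 1\<^sub>m n \<and>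
    mat_adjoint U * H * U = mat_diag n (\<lambda>i. complex_of_real (d i))"
  using assms
proof (induction n arbitrary: H)
  case 0
  then show ?case
    by (intro exI[of _ "1\<^sub>m 0"] exI[of _ "\<lambda>_. 0"]) (auto intro!: eq_matI simp: mat_diag_def)
next
  case (Suc n)
  note H = Suc.prems(1) and hH = Suc.prems(2)
  obtain as where cp: "char_poly H = (\<Prod>a\<leftarrow>as. [:- a, 1:])" "length as = Suc n"
    using char_poly_factorized[OF H] by blast
  then obtain e as' where as: "as = e # as'" by (cases as) auto
  have "eigenvalue H e" unfolding eigenvalue_root_char_poly[OF H] cp as by simp
  then obtain v where v: "v \<in> carrier_vec (Suc n)" "v \<noteq> 0\<^sub>v (Suc n)" "H *\<^sub>v v = e \<cdot>\<^sub>v v"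
    using H unfolding eigenvalue_def eigenvector_def by auto
  obtain W c where W: "W \<in> carrier_mat (Suc n) (Suc n)" "mat_adjoint W * W = 1\<^sub>m (Suc n)"
    and Wv: "col W 0 = c \<cdot>\<^sub>v v" "c \<noteq> 0"
    using exists_unitary_first_col[OF v(1,2)] by blast
  define B where "B = mat_adjoint W * H * W"
  have B: "B \<in> carrier_mat (Suc n) (Suc n)" 
    unfolding B_def using W H by (intro mult_carrier_mat mat_adjoint_carrier)
  have hB: "hermitian_mat B" unfolding B_def by (rule hermitian_mat_congruence[OF hH H W(1)])
  have B_col: "B $$ (i, 0) = (if i = 0 then e else 0)" if i: "i < Suc n" for i
  proof -
    have "col (H * W) 0 = e \<cdot>\<^sub>v col W 0"
    proof -
      have "col (H * W) 0 = H *\<^sub>v col W 0" using H W by (intro col_mult2) auto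
      also have "\<dots> = c \<cdot>\<^sub>v (e \<cdot>\<^sub>v v)" using H v Wv by (simp add: mult_mat_vec[of _ "Suc n" "Suc n"])
      finally show ?thesis using v by (auto simp: Wv smult_smult_assoc mult.commute)
    qed
    moreover have "B = mat_adjoint W * (H * W)"
      unfolding B_def using H W by (intro assoc_mult_mat) auto
    ultimately have "B $$ (i, 0) = row (mat_adjoint W) i \<bullet> (e \<cdot>\<^sub>v col W 0)"
      using W H i by simp
    also have "\<dots> = e * (row (mat_adjoint W) i \<bullet> col W 0)"
      by (rule scalar_prod_smult_distrib[of _ "Suc n"]) (use W(1) i in \<open>auto intro: carrier_vecI\<close>)
    also have "row (mat_adjoint W) i \<bullet> col W 0 = (mat_adjoint W * W) $$ (i, 0)"
      using W(1) i by simp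
    finally show ?thesis using W i by simp
  qed
  have e_real: "cnj e = e" "complex_of_real (Re e) = e"
    using hermitian_matD[OF hB B, of 0 0] B_col[of 0] by (simp_all add: complex_eq_iff)
  define H' where "H' = mat n n (\<lambda>(i, j). B $$ (Suc i, Suc j))"
  have H': "H' \<in> carrier_mat n n" by (simp add: H'_def)
  have hH': "hermitian_mat H'"
    unfolding hermitian_mat_def
  proof (rule eq_matI)
    fix i j assume "i < dim_row H'" "j < dim_col H'"
    then have ij: "i < n" "j < n" using H' by auto
    then show "mat_adjoint H' $$ (i, j) = H' $$ (i, j)"
      using hermitian_matD[OF hB B, of "Suc i" "Suc j", symmetric] by (simp add: H'_def)
  qed (use H' in auto)
  obtain U d where U: "U \<in> carrier_mat n n" "mat_adjoint U * U = 1\<^sub>m n"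
    and UH: "mat_adjoint U * H' * U = mat_diag n (\<lambda>i. complex_of_real (d i))"
    using Suc.IH[OF H' hH'] by blast
  define E where "E = mat 1 1 (\<lambda>_. e)"
  \<comment> \<open>The unitary of the induction hypothesis, extended so that it fixes the
    eigenvector already split off. The diagonalising unitary is then \<open>W * V\<close>.\<close>
  define V where "V = four_block_mat (1\<^sub>m 1) (0\<^sub>m 1 n) (0\<^sub>m n 1) U"
  define d' where "d' i = (case i of 0 \<Rightarrow> Re e | Suc j \<Rightarrow> d j)" for i
  have BE: "B = four_block_mat E (0\<^sub>m 1 n) (0\<^sub>m n 1) H'"
  proof (rule eq_matI)
    fix i j assume "i < dim_row (four_block_mat E (0\<^sub>m 1 n) (0\<^sub>m n 1) H')"
      "j < dim_col (four_block_mat E (0\<^sub>m 1 n) (0\<^sub>m n 1) H')"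
    then have ij: "i < Suc n" "j < Suc n" by (auto simp: E_def H'_def)
    \<comment> \<open>The first row is the conjugate of the first column, which \<open>B_col\<close>
      describes.\<close>
    have "B $$ (0, j) = (if j = 0 then e else 0)"
      using hermitian_matD[OF hB B, of 0 j] B_col[of j] ij e_real(1) by (cases "j = 0") auto
    then show "B $$ (i, j) = four_block_mat E (0\<^sub>m 1 n) (0\<^sub>m n 1) H' $$ (i, j)"
      using B_col[of i] ij by (cases i; cases j) (auto simp: E_def H'_def)
  qed (use B in \<open>auto simp: E_def H'_def\<close>)
  have E: "E \<in> carrier_mat 1 1" by (simp add: E_def)
  have V: "V \<in> carrier_mat (Suc n) (Suc n)"
    unfolding V_def using four_block_carrier_mat[OF one_carrier_mat[of 1] U(1)] by simp
  have zero_adj: "mat_adjoint (0\<^sub>m m k) = (0\<^sub>m k m :: complex mat)" for m k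
    by (rule eq_matI) (auto simp: conjugate_complex_def)
  have adjV: "mat_adjoint V = four_block_mat (1\<^sub>m 1) (0\<^sub>m 1 n) (0\<^sub>m n 1) (mat_adjoint U)"
    unfolding V_def using mat_adjoint_four_block_mat[OF one_carrier_mat zero_carrier_mat zero_carrier_mat U(1)]
    by (simp add: zero_adj)
  note U' = mat_adjoint_carrier[OF U(1)]
  note UH'_carrier = mult_carrier_mat[OF U' H']
  note blocks = zero_carrier_mat[of 1 n] zero_carrier_mat[of n 1]
  have VV: "mat_adjoint V * V = 1\<^sub>m (Suc n)"
    unfolding adjV unfolding V_def mult_four_block_mat[OF one_carrier_mat blocks U' one_carrier_mat blocks U(1)]
    using U four_block_one_mat[of 1 n, where ?'a = complex] by simp
  have VBV: "mat_adjoint V * B * V = mat_diag (Suc n) (\<lambda>i. complex_of_real (d' i))"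
  proof -
    have "mat_adjoint V * B = four_block_mat E (0\<^sub>m 1 n) (0\<^sub>m n 1) (mat_adjoint U * H')"
      unfolding adjV BE mult_four_block_mat[OF one_carrier_mat blocks U' E blocks H']
      using E H' U(1) U' UH'_carrier by simp
    then have "mat_adjoint V * B * V = four_block_mat E (0\<^sub>m 1 n) (0\<^sub>m n 1) (mat_adjoint U * H' * U)"
      unfolding V_def
      using mult_four_block_mat[OF E blocks UH'_carrier one_carrier_mat blocks U(1)]
        E U(1) UH'_carrier mult_carrier_mat[OF UH'_carrier U(1)]
        right_mult_zero_mat[OF UH'_carrier, of 1]
      by simp
    also have "\<dots> = mat_diag (Suc n) (\<lambda>i. complex_of_real (d' i))"
      unfolding UH using e_real(2)
      by (intro eq_matI) (auto simp: E_def mat_diag_def d'_def split: nat.splits)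
    finally show ?thesis .
  qed
  have adjWV: "mat_adjoint (W * V) = mat_adjoint V * mat_adjoint W"
    using W V by (intro mat_adjoint_mult) auto
  have "mat_adjoint (W * V) * (W * V) = mat_adjoint V * (mat_adjoint W * (W * V))"
    unfolding adjWV using W V by (intro assoc_mult_mat) auto
  then have "mat_adjoint (W * V) * (W * V) = 1\<^sub>m (Suc n)"
    using mult_mat_inverse_cancel[OF W(2) _ W(1) V] W V VV by simp
  moreover have "mat_adjoint (W * V) * H * (W * V) = mat_diag (Suc n) (\<lambda>i. complex_of_real (d' i))"
    unfolding adjWV VBV[symmetric] B_def
    by (rule mult_mat_regroup5[OF mat_adjoint_carrier[OF V] mat_adjoint_carrier[OF W(1)] H W(1) V])
  ultimately show ?case
    using W V by (intro exI[of _ "W * V"] exI[of _ d']) auto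
qed

section \<open>Positive definite matrices: diagonal entries, congruence, diagonal blocks\<close>

lemma cscalar_prod_unit_vec:
  assumes "(A :: complex mat) \<in> carrier_mat n n" "i < n"
  shows "(A *\<^sub>v unit_vec n i) \<bullet>c unit_vec n i = A $$ (i, i)"
proof -
  have "conjugate (unit_vec n i :: complex vec) = unit_vec n i"
    by (intro eq_vecI) (auto simp: unit_vec_def)
  then show ?thesis using assms by simp
qed

lemma pos_def_mat_diag_pos:
  assumes "pos_def_mat A" "A \<in> carrier_mat n n" "i < n"
  shows "Re (A $$ (i, i)) > 0"
proof -
  have "unit_vec n i \<noteq> (0\<^sub>v n :: complex vec)"
    using assms(3) by (metis index_unit_vec(2) index_zero_vec(1) zero_neq_one)
  then show ?thesis
    using assms cscalar_prod_unit_vec[OF assms(2,3)] unfolding pos_def_mat_def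
    by (metis carrier_matD(1) unit_vec_carrier)
qed

text \<open>The form of the congruent matrix at \<open>v\<close> is the form of \<open>A\<close> at
  \<open>W *\<^sub>v v\<close>, and injectivity keeps that vector nonzero.\<close>

lemma pos_def_mat_congruence:
  fixes W :: "complex mat"
  assumes "pos_def_mat A" "A \<in> carrier_mat n n" "W \<in> carrier_mat n k"
    and inj: "\<And>v. v \<in> carrier_vec k \<Longrightarrow> W *\<^sub>v v = 0\<^sub>v n \<Longrightarrow> v = 0\<^sub>v k"
  shows "pos_def_mat (mat_adjoint W * A * W)"
  unfolding pos_def_mat_def
proof (intro conjI ballI impI)
  show "hermitian_mat (mat_adjoint W * A * W)"
    using assms hermitian_mat_congruence by (auto simp: pos_def_mat_def)
  fix v :: "complex vec" assume v: "v \<in> carrier_vec (dim_row (mat_adjoint W * A * W))"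
    "v \<noteq> 0\<^sub>v (dim_row (mat_adjoint W * A * W))"
  then have v: "v \<in> carrier_vec k" "v \<noteq> 0\<^sub>v k" using assms by auto
  have Wv: "W *\<^sub>v v \<in> carrier_vec n" "W *\<^sub>v v \<noteq> 0\<^sub>v n" using assms v by auto
  have AWv: "A *\<^sub>v (W *\<^sub>v v) \<in> carrier_vec n" using assms(2) Wv by auto
  have "(mat_adjoint W * A * W) *\<^sub>v v = (mat_adjoint W * A) *\<^sub>v (W *\<^sub>v v)"
    using assms v mult_carrier_mat[OF mat_adjoint_carrier[OF assms(3)] assms(2)]
    by (intro assoc_mult_mat_vec) auto
  also have "\<dots> = mat_adjoint W *\<^sub>v (A *\<^sub>v (W *\<^sub>v v))"
    using assms Wv by (intro assoc_mult_mat_vec[where ?n\<^sub>2.0 = n]) auto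
  finally have "((mat_adjoint W * A * W) *\<^sub>v v) \<bullet>c v = (A *\<^sub>v (W *\<^sub>v v)) \<bullet>c (W *\<^sub>v v)"
    using mat_adjoint_scalar_prod[OF mat_adjoint_carrier[OF assms(3)] AWv v(1)] by simp
  then show "0 < Re (((mat_adjoint W * A * W) *\<^sub>v v) \<bullet>c v)"
    using assms(1,2) Wv unfolding pos_def_mat_def by auto
qed

lemma left_inverse_mult_vec_inj:
  fixes W :: "'a :: comm_ring_1 mat"
  assumes "W \<in> carrier_mat n k" "W' \<in> carrier_mat k n" "W' * W = 1\<^sub>m k"
    "v \<in> carrier_vec k" "W *\<^sub>v v = 0\<^sub>v n"
  shows "v = 0\<^sub>v k"
proof -
  have "v = (W' * W) *\<^sub>v v" using assms by simp
  also have "\<dots> = W' *\<^sub>v (W *\<^sub>v v)" using assms(1,2,4) by (intro assoc_mult_mat_vec)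
  finally show ?thesis using assms by auto
qed

text \<open>The version applied below, where \<open>W\<close> always comes with an explicit inverse:
  the adjoint of a unitary or a block triangular matrix.\<close>

lemma pos_def_mat_congruence_inverse:
  assumes "pos_def_mat A" "A \<in> carrier_mat n n" "W \<in> carrier_mat n k"
    "W' \<in> carrier_mat k n" "W' * W = 1\<^sub>m k"
  shows "pos_def_mat (mat_adjoint W * A * W)"
  using pos_def_mat_congruence[OF assms(1-3)] left_inverse_mult_vec_inj[OF assms(3-5)] by blast

lemma conjugate_append_vec:
  fixes v :: "'a :: conjugatable_ring vec"
  shows "conjugate (v @\<^sub>v w) = conjugate v @\<^sub>v conjugate w"
  by (rule eq_vecI) auto

text \<open>Padding a vector with zeros restricts the quadratic form to one diagonal block.\<close>

lemma pos_def_mat_four_block: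
  assumes "pos_def_mat (four_block_mat A B C D)" "A \<in> carrier_mat n n" "B \<in> carrier_mat n m"
    "C \<in> carrier_mat m n" "D \<in> carrier_mat m m"
  shows "pos_def_mat A" "pos_def_mat D"
proof -
  let ?M = "four_block_mat A B C D"
  have M: "?M \<in> carrier_mat (n + m) (n + m)" using assms by auto
  have h: "hermitian_mat ?M" using assms(1) by (simp add: pos_def_mat_def)
  have pos: "Re ((?M *\<^sub>v x) \<bullet>c x) > 0" if "x \<in> carrier_vec (n + m)" "x \<noteq> 0\<^sub>v (n + m)" for x
    using assms(1) M that unfolding pos_def_mat_def by auto
  have zero_append: "0\<^sub>v n @\<^sub>v 0\<^sub>v m = (0\<^sub>v (n + m) :: complex vec)"
    by (rule eq_vecI) auto
  have zero: "X *\<^sub>v 0\<^sub>v l = 0\<^sub>v k" if "X \<in> carrier_mat k l" for X :: "complex mat" and k l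
    using that by (intro eq_vecI) auto
  show "pos_def_mat A"
    unfolding pos_def_mat_def
  proof (intro conjI ballI impI)
    show "hermitian_mat A"
      unfolding hermitian_mat_def
    proof (rule eq_matI)
      fix i j assume "i < dim_row A" "j < dim_col A"
      then show "mat_adjoint A $$ (i, j) = A $$ (i, j)"
        using hermitian_matD[OF h M, of i j] assms by simp
    qed (use assms in auto)
    fix v :: "complex vec" assume "v \<in> carrier_vec (dim_row A)" "v \<noteq> 0\<^sub>v (dim_row A)"
    then have v: "v \<in> carrier_vec n" "v \<noteq> 0\<^sub>v n" using assms by auto
    have "?M *\<^sub>v (v @\<^sub>v 0\<^sub>v m) = (A *\<^sub>v v) @\<^sub>v (C *\<^sub>v v)"
      using assms v by (subst four_block_mat_mult_vec[of _ n n _ m _ m]) (auto simp: zero)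
    moreover have "v @\<^sub>v 0\<^sub>v m \<noteq> 0\<^sub>v (n + m)"
      using v append_vec_eq[OF v(1) zero_carrier_vec[of n], of "0\<^sub>v m" "0\<^sub>v m"]
      unfolding zero_append[symmetric] by blast
    ultimately show "0 < Re ((A *\<^sub>v v) \<bullet>c v)"
      using pos[of "v @\<^sub>v 0\<^sub>v m"] assms v
      by (simp add: conjugate_append_vec scalar_prod_append[of _ n _ m])
  qed
  show "pos_def_mat D"
    unfolding pos_def_mat_def
  proof (intro conjI ballI impI)
    show "hermitian_mat D"
      unfolding hermitian_mat_def
    proof (rule eq_matI)
      fix i j assume "i < dim_row D" "j < dim_col D"
      then show "mat_adjoint D $$ (i, j) = D $$ (i, j)"
        using hermitian_matD[OF h M, of "n + i" "n + j"] assms by simp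
    qed (use assms in auto)
    fix v :: "complex vec" assume "v \<in> carrier_vec (dim_row D)" "v \<noteq> 0\<^sub>v (dim_row D)"
    then have v: "v \<in> carrier_vec m" "v \<noteq> 0\<^sub>v m" using assms by auto
    have "?M *\<^sub>v (0\<^sub>v n @\<^sub>v v) = (B *\<^sub>v v) @\<^sub>v (D *\<^sub>v v)"
      using assms v by (subst four_block_mat_mult_vec[of _ n n _ m _ m]) (auto simp: zero)
    moreover have "0\<^sub>v n @\<^sub>v v \<noteq> 0\<^sub>v (n + m)"
      using v append_vec_eq[OF zero_carrier_vec[of n] zero_carrier_vec[of n], of v "0\<^sub>v m"]
      unfolding zero_append[symmetric] by blast
    ultimately show "0 < Re ((D *\<^sub>v v) \<bullet>c v)"
      using pos[of "0\<^sub>v n @\<^sub>v v"] assms v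
      by (simp add: conjugate_append_vec scalar_prod_append[of _ n _ m])
  qed
qed

section \<open>Unitary conjugation and the positive definite square root\<close>

lemma mult_unitary_conj_cancel:
  fixes U :: "complex mat"
  assumes "U \<in> carrier_mat n n" "mat_adjoint U * U = 1\<^sub>m n" "A \<in> carrier_mat n n"
  shows "U * (mat_adjoint U * A * U) * mat_adjoint U = A"
proof -
  have UU: "U * mat_adjoint U = 1\<^sub>m n"
    using assms mat_mult_left_right_inverse[of "mat_adjoint U" n U] by auto
  have "U * (mat_adjoint U * A * U) = U * (mat_adjoint U * (A * U))"
    using assms by (simp add: assoc_mult_mat[of _ n n _ n _ n])
  also have "\<dots> = A * U"
    using assms by (intro mult_mat_inverse_cancel[OF UU]) auto
  finally show ?thesis using assms UU by (simp add: assoc_mult_mat[of _ n n _ n _ n])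
qed

text \<open>The inner \<open>U * V\<close> collapses, so conjugation is multiplicative. This carries
  squares and the resolvent equation through a diagonalisation.\<close>

lemma sandwich_mult:
  fixes U :: "'a :: semiring_1 mat"
  assumes U: "U \<in> carrier_mat n n" and V: "V \<in> carrier_mat n n" and UV: "U * V = 1\<^sub>m n"
    and X: "X \<in> carrier_mat n n" and Y: "Y \<in> carrier_mat n n"
  shows "(V * X * U) * (V * Y * U) = V * (X * Y) * U"
proof -
  note assoc = assoc_mult_mat[of _ n n _ n _ n]
  have "U * (V * (Y * U)) = Y * U"
    by (rule mult_mat_inverse_cancel[OF UV U V mult_carrier_mat[OF Y U]])
  then show ?thesis
    using U V X Y by (simp add: assoc)
qed

lemma sandwich_minus:
  fixes U :: "'a :: ring mat"
  assumes U: "U \<in> carrier_mat n n" and V: "V \<in> carrier_mat n n"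
    and X: "X \<in> carrier_mat n n" and Y: "Y \<in> carrier_mat n n"
  shows "V * (X - Y) * U = V * X * U - V * Y * U"
  unfolding mult_minus_distrib_mat[OF V X Y]
  by (rule minus_mult_distrib_mat[OF mult_carrier_mat[OF V X] mult_carrier_mat[OF V Y] U])

text \<open>In an eigenbasis the matrix is diagonal with positive entries, because congruence
  preserves positive definiteness. The entrywise root is conjugated back.\<close>

lemma pos_def_mat_sqrt_exists:
  assumes "pos_def_mat A" "A \<in> carrier_mat n n"
  shows "\<exists>B \<in> carrier_mat n n. pos_def_mat B \<and> B * B = A"
proof -
  obtain U d where U: "U \<in> carrier_mat n n" "mat_adjoint U * U = 1\<^sub>m n"
    and UA: "mat_adjoint U * A * U = mat_diag n (\<lambda>i. complex_of_real (d i))"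
    using hermitian_spectral[OF assms(2)] assms(1) by (auto simp: pos_def_mat_def)
  have UU: "U * mat_adjoint U = 1\<^sub>m n"
    using U mat_mult_left_right_inverse[of "mat_adjoint U" n U] by auto
  have d: "d i > 0" if "i < n" for i
    using pos_def_mat_diag_pos[OF pos_def_mat_congruence_inverse[OF assms U(1) _ U(2)], of n i] that U(1) UA
    by (simp add: mat_diag_def)
  define S where "S = mat_diag n (\<lambda>i. complex_of_real (sqrt (d i)))"
  have S: "S \<in> carrier_mat n n" by (simp add: S_def)
  have SS: "S * S = mat_adjoint U * A * U"
    unfolding UA S_def mat_diag_diag using d
    by (auto simp: mat_diag_def less_imp_le simp flip: of_real_mult intro!: eq_matI)
  have "pos_def_mat S"
    unfolding pos_def_mat_def
  proof (intro conjI ballI impI)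
    show "hermitian_mat S" by (simp add: S_def hermitian_mat_def mat_adjoint_mat_diag_of_real)
    fix v :: "complex vec" assume "v \<in> carrier_vec (dim_row S)" "v \<noteq> 0\<^sub>v (dim_row S)"
    then have v: "v \<in> carrier_vec n" "v \<noteq> 0\<^sub>v n" using S by auto
    then obtain j where j: "j < n" "v $ j \<noteq> 0"
      by (metis carrier_vecD eq_vecI index_zero_vec)
    have "(S *\<^sub>v v) $ i = complex_of_real (sqrt (d i)) * v $ i" if "i < n" for i
      using that v(1) by (auto simp: S_def mat_diag_def scalar_prod_def if_distrib[of "\<lambda>x. x * _"] sum.delta cong: if_cong)
    then have "(S *\<^sub>v v) \<bullet>c v = (\<Sum>i<n. complex_of_real (sqrt (d i)) * v $ i * cnj (v $ i))"
      using v(1) S by (auto simp: scalar_prod_def lessThan_atLeast0)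
    then have "Re ((S *\<^sub>v v) \<bullet>c v) = (\<Sum>i<n. sqrt (d i) * (cmod (v $ i))\<^sup>2)"
      by (simp add: mult.assoc complex_mult_cnj cmod_power2)
    also have "\<dots> > 0"
      using j d by (intro sum_pos2[of _ j]) (auto simp: less_imp_le)
    finally show "0 < Re ((S *\<^sub>v v) \<bullet>c v)" .
  qed
  then have "pos_def_mat (U * S * mat_adjoint U)"
    using pos_def_mat_congruence_inverse[of S n "mat_adjoint U" n U] U UU S by simp
  moreover have "U * S * mat_adjoint U * (U * S * mat_adjoint U) = A"
    using sandwich_mult[OF mat_adjoint_carrier[OF U(1)] U(1) U(2) S S] mult_unitary_conj_cancel[OF U assms(2)]
    unfolding SS by (rule trans)
  moreover have "U * S * mat_adjoint U \<in> carrier_mat n n"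
    using U S by (intro mult_carrier_mat mat_adjoint_carrier)
  ultimately show ?thesis by blast
qed

text \<open>In an eigenbasis of \<open>B - C\<close> the two matrices agree off the diagonal, so comparing the diagonal
  entries of their squares leaves \<open>b\<^sub>i\<^sub>i\<^sup>2 = c\<^sub>i\<^sub>i\<^sup>2\<close> with both entries positive.\<close>

lemma pos_def_mat_sqrt_unique:
  assumes "pos_def_mat B" "B \<in> carrier_mat n n" "pos_def_mat C" "C \<in> carrier_mat n n"
    and eq: "B * B = C * C"
  shows "B = C"
proof -
  have "hermitian_mat (B - C)"
    using assms by (simp add: hermitian_mat_def pos_def_mat_def mat_adjoint_minus[of _ n n])
  moreover have BC: "B - C \<in> carrier_mat n n" using assms by auto
  ultimately obtain U d where U: "U \<in> carrier_mat n n" "mat_adjoint U * U = 1\<^sub>m n"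
    and UBC: "mat_adjoint U * (B - C) * U = mat_diag n (\<lambda>i. complex_of_real (d i))"
    using hermitian_spectral by blast
  have UU: "U * mat_adjoint U = 1\<^sub>m n"
    using U mat_mult_left_right_inverse[of "mat_adjoint U" n U] by auto
  define conj where "conj X = mat_adjoint U * X * U" for X
  have conj_carrier: "conj X \<in> carrier_mat n n" if "X \<in> carrier_mat n n" for X
    unfolding conj_def using that U by (intro mult_carrier_mat mat_adjoint_carrier)
  have conj_mult: "conj X * conj X = conj (X * X)" if X: "X \<in> carrier_mat n n" for X
    unfolding conj_def using sandwich_mult[OF U(1) mat_adjoint_carrier[OF U(1)] UU X X] .
  have pd: "pos_def_mat (conj B)" "pos_def_mat (conj C)"
    unfolding conj_def
    using pos_def_mat_congruence_inverse[OF _ _ U(1) mat_adjoint_carrier[OF U(1)] U(2)] assms(1-4) by blast+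
  have diff: "conj B $$ (i, j) - conj C $$ (i, j) = (if i = j then complex_of_real (d i) else 0)"
    if "i < n" "j < n" for i j
  proof -
    have "conj (B - C) = conj B - conj C"
      unfolding conj_def by (rule sandwich_minus[OF U(1) mat_adjoint_carrier[OF U(1)] assms(2,4)])
    then have "conj B - conj C = mat_diag n (\<lambda>i. complex_of_real (d i))"
      using UBC unfolding conj_def by metis
    from arg_cong[OF this, of "\<lambda>X. X $$ (i, j)"] show ?thesis
      using that conj_carrier[OF assms(4)] by (simp add: mat_diag_def)
  qed
  have "conj B = conj C"
  proof (rule eq_matI)
    fix i j assume "i < dim_row (conj C)" "j < dim_col (conj C)"
    then have ij: "i < n" "j < n" using conj_carrier[OF assms(4)] by auto
    show "conj B $$ (i, j) = conj C $$ (i, j)"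
    proof (cases "i = j")
      case False
      then show ?thesis using diff[OF ij] by simp
    next
      case True
      have square: "(X * X) $$ (i, i) = X $$ (i, i) * X $$ (i, i) + (\<Sum>k \<in> {0..<n} - {i}. X $$ (i, k) * X $$ (k, i))"
        if "X \<in> carrier_mat n n" for X :: "complex mat"
        using that ij by (simp add: scalar_prod_def sum.remove[of _ i])
      have "conj B $$ (i, k) = conj C $$ (i, k)" "conj B $$ (k, i) = conj C $$ (k, i)" if "k \<in> {0..<n} - {i}" for k
        using diff[of i k] diff[of k i] that ij by auto
      then have sums: "(\<Sum>k \<in> {0..<n} - {i}. conj B $$ (i, k) * conj B $$ (k, i)) =
          (\<Sum>k \<in> {0..<n} - {i}. conj C $$ (i, k) * conj C $$ (k, i))"
        by (intro sum.cong refl) metis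
      have "conj B * conj B = conj C * conj C"
        using conj_mult[OF assms(2)] conj_mult[OF assms(4)] eq by metis
      from arg_cong[OF this, of "\<lambda>X. X $$ (i, i)"]
      have "conj B $$ (i, i) * conj B $$ (i, i) = conj C $$ (i, i) * conj C $$ (i, i)"
        unfolding square[OF conj_carrier[OF assms(2)]] square[OF conj_carrier[OF assms(4)]] sums
        by (rule add_right_imp_eq)
      then have "conj B $$ (i, i) = conj C $$ (i, i) \<or> conj B $$ (i, i) = - conj C $$ (i, i)"
        by (simp add: square_eq_iff)
      moreover have "Re (conj B $$ (i, i)) > 0" "Re (conj C $$ (i, i)) > 0"
        using pos_def_mat_diag_pos pd conj_carrier assms(2,4) ij by blast+
      ultimately show ?thesis using True by auto
    qed
  qed (use conj_carrier assms in auto)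
  then show ?thesis
    using mult_unitary_conj_cancel[OF U] assms(2,4) unfolding conj_def by metis
qed

text \<open>Existence and uniqueness together discharge the definite description; everything later
  about \<open>pd_sqrt\<close> goes through these three facts.\<close>

lemma pd_sqrt:
  assumes "pos_def_mat A" "A \<in> carrier_mat n n"
  shows "pd_sqrt A \<in> carrier_mat n n" "pos_def_mat (pd_sqrt A)" "pd_sqrt A * pd_sqrt A = A"
proof -
  have dim: "dim_row A = n" using assms(2) by simp
  have "\<exists>!B. B \<in> carrier_mat n n \<and> pos_def_mat B \<and> B * B = A"
    using pos_def_mat_sqrt_exists[OF assms] pos_def_mat_sqrt_unique by blast
  then have "pd_sqrt A \<in> carrier_mat n n \<and> pos_def_mat (pd_sqrt A) \<and> pd_sqrt A * pd_sqrt A = A"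
    unfolding pd_sqrt_def dim by (rule theI')
  then show "pd_sqrt A \<in> carrier_mat n n" "pos_def_mat (pd_sqrt A)" "pd_sqrt A * pd_sqrt A = A"
    by blast+
qed

section \<open>Matrix inverses and inverse square roots\<close>

text \<open>\<open>mat_inv\<close> applies \<open>the\<close> to an option, so the point is that the
  option is not \<open>None\<close>: a trivial kernel gives a nonzero determinant, hence a unit of
  the matrix ring.\<close>

lemma mat_inv_invertible:
  assumes A: "A \<in> carrier_mat n n" and inj: "\<And>v. v \<in> carrier_vec n \<Longrightarrow> A *\<^sub>v v = 0\<^sub>v n \<Longrightarrow> v = 0\<^sub>v n"
  shows "mat_inv A \<in> carrier_mat n n" "A * mat_inv A = 1\<^sub>m n" "mat_inv A * A = 1\<^sub>m n"
proof -
  have "det A \<noteq> 0" using det_0_iff_vec_prod_zero_field[OF A] inj by blast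
  then have "A \<in> Units (ring_mat TYPE(complex) n ())" by (rule det_non_zero_imp_unit[OF A])
  then have "mat_inverse A \<noteq> None" using mat_inverse(1)[OF A, of "()"] by blast
  then obtain B where B: "mat_inverse A = Some B" by blast
  have inv: "mat_inv A = B" by (simp add: mat_inv_def B)
  show "mat_inv A \<in> carrier_mat n n" "A * mat_inv A = 1\<^sub>m n" "mat_inv A * A = 1\<^sub>m n"
    unfolding inv using mat_inverse(2)[OF A B] by blast+
qed

lemma mat_inv_eqI:
  assumes "A \<in> carrier_mat n n" "B \<in> carrier_mat n n" "A * B = 1\<^sub>m n"
  shows "mat_inv A = B"
proof -
  have BA: "B * A = 1\<^sub>m n" using mat_mult_left_right_inverse assms by blast
  note inv = mat_inv_invertible[OF assms(1) left_inverse_mult_vec_inj[OF assms(1,2) BA]]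
  have "mat_inv A = mat_inv A * (A * B)" using assms inv by simp
  also have "\<dots> = B" using mult_mat_inverse_cancel[OF inv(3) inv(1) assms(1,2)] .
  finally show ?thesis .
qed

lemma pos_def_mat_mult_vec_inj:
  assumes "pos_def_mat A" "A \<in> carrier_mat n n" "v \<in> carrier_vec n" "A *\<^sub>v v = 0\<^sub>v n"
  shows "v = 0\<^sub>v n"
proof (rule ccontr)
  assume "v \<noteq> 0\<^sub>v n"
  then have "Re ((A *\<^sub>v v) \<bullet>c v) > 0" using assms unfolding pos_def_mat_def by auto
  then show False using assms by simp
qed

text \<open>Taking adjoints in \<open>T * S = 1\<^sub>m n\<close> shows that the adjoint of
  \<open>T\<close> is also an inverse of \<open>S\<close>; inverses are unique.\<close>

lemma mat_adjoint_inverse: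
  fixes S :: "complex mat"
  assumes "hermitian_mat S" "S \<in> carrier_mat n n" "T \<in> carrier_mat n n" "S * T = 1\<^sub>m n"
  shows "mat_adjoint T = T"
proof -
  have TS: "T * S = 1\<^sub>m n" using mat_mult_left_right_inverse assms by blast
  have "S * mat_adjoint T = 1\<^sub>m n"
    using mat_adjoint_mult[OF assms(3,2)] assms(1) TS by (simp add: hermitian_mat_def)
  then show ?thesis
    using mat_inv_eqI[OF assms(2)] assms by (metis mat_adjoint_carrier)
qed

lemma pd_inv_sqrt:
  assumes "pos_def_mat A" "A \<in> carrier_mat n n"
  shows "pd_inv_sqrt A \<in> carrier_mat n n" "mat_adjoint (pd_inv_sqrt A) = pd_inv_sqrt A"
    "pd_sqrt A * pd_inv_sqrt A = 1\<^sub>m n" "pd_inv_sqrt A * pd_sqrt A = 1\<^sub>m n"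
proof -
  note S = pd_sqrt[OF assms]
  note inv = mat_inv_invertible[OF S(1) pos_def_mat_mult_vec_inj[OF S(2,1)], folded pd_inv_sqrt_def]
  show "pd_inv_sqrt A \<in> carrier_mat n n" by (rule inv(1))
  show "pd_sqrt A * pd_inv_sqrt A = 1\<^sub>m n" by (rule inv(2))
  show "pd_inv_sqrt A * pd_sqrt A = 1\<^sub>m n" by (rule inv(3))
  show "mat_adjoint (pd_inv_sqrt A) = pd_inv_sqrt A"
    using S(2) by (intro mat_adjoint_inverse[OF _ S(1) inv(1,2)]) (auto simp: pos_def_mat_def)
qed

section \<open>Multisets of eigenvalues\<close>

lemma size_eigenvalues_mset: "A \<in> carrier_mat n n \<Longrightarrow> size (eigenvalues_mset A) = n"
  unfolding eigenvalues_mset_def size_proots_complex using degree_monic_char_poly by blast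

lemma char_poly_nonzero: "(A :: complex mat) \<in> carrier_mat n n \<Longrightarrow> char_poly A \<noteq> 0"
  using degree_monic_char_poly[of A n] by auto

lemma eigenvalues_mset_similar: "similar_mat A B \<Longrightarrow> eigenvalues_mset A = eigenvalues_mset B"
  unfolding eigenvalues_mset_def by (simp add: char_poly_similar)

lemma proots_linear_factors:
  "proots (\<Prod>a\<leftarrow>as. [:- a, 1:]) = mset (as :: complex list)"
proof (induction as)
  case (Cons a as)
  have "(\<Prod>a\<leftarrow>as. [:- a, 1:]) \<noteq> (0 :: complex poly)"
    by (auto simp: prod_list_zero_iff)
  then have "proots ([:- a, 1:] * (\<Prod>a\<leftarrow>as. [:- a, 1:])) = proots [:- a, 1:] + mset as"
    using Cons.IH by (subst proots_mult) auto
  then show ?case by simp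
qed simp

lemma eigenvalues_mset_mat_diag:
  "eigenvalues_mset (mat_diag n f) = image_mset f (mset_set {0..<n})"
proof -
  have "char_poly (mat_diag n f) = (\<Prod>a\<leftarrow>diag_mat (mat_diag n f). [:- a, 1:])"
    by (rule char_poly_upper_triangular[of _ n]) (auto simp: mat_diag_def)
  moreover have "diag_mat (mat_diag n f) = map f [0..<n]"
    by (auto simp: diag_mat_def mat_diag_def)
  ultimately have "eigenvalues_mset (mat_diag n f) = mset (map f [0..<n])"
    unfolding eigenvalues_mset_def by (simp only: proots_linear_factors)
  then show ?thesis by simp
qed

lemma eigenvalues_mset_zero: "eigenvalues_mset (0\<^sub>m n n) = replicate_mset n 0"
proof -
  have "0\<^sub>m n n = mat_diag n (\<lambda>_. 0 :: complex)"
    by (rule eq_matI) (auto simp: mat_diag_def)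
  then show ?thesis by (simp add: eigenvalues_mset_mat_diag image_mset_const_eq)
qed

lemma eigenvalues_mset_lower_block:
  assumes B: "B \<in> carrier_mat n n" and C: "C \<in> carrier_mat m n" and D: "D \<in> carrier_mat m m"
  shows "eigenvalues_mset (four_block_mat B (0\<^sub>m n m) C D) = eigenvalues_mset B + eigenvalues_mset D"
proof -
  have "char_poly (four_block_mat B (0\<^sub>m n m) C D) = char_poly B * char_poly D"
    using char_poly_factorized[OF B] char_poly_factorized[OF D]
    by (intro char_poly_0_block'[OF refl _ _ B C D]) blast+
  then show ?thesis
    unfolding eigenvalues_mset_def
    by (simp only: proots_mult[OF char_poly_nonzero[OF B] char_poly_nonzero[OF D]])
qed

text \<open>The block matrices \<open>[[B C, 0], [C, 0]]\<close> and \<open>[[0, 0], [C, C B]]\<close> are conjugate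
  under \<open>[[1, B], [0, 1]]\<close>.\<close>

lemma eigenvalues_mset_mult_commute:
  assumes B: "B \<in> carrier_mat n m" and C: "C \<in> carrier_mat m n"
  shows "eigenvalues_mset (B * C) + replicate_mset m 0 = eigenvalues_mset (C * B) + replicate_mset n 0"
proof -
  define X where "X = four_block_mat (B * C) (0\<^sub>m n m) C (0\<^sub>m m m)"
  define Y where "Y = four_block_mat (0\<^sub>m n n) (0\<^sub>m n m) C (C * B)"
  define T where "T = four_block_mat (1\<^sub>m n) B (0\<^sub>m m n) (1\<^sub>m m)"
  define T' where "T' = four_block_mat (1\<^sub>m n) (- B) (0\<^sub>m m n) (1\<^sub>m m)"
  have BC: "B * C \<in> carrier_mat n n" and CB: "C * B \<in> carrier_mat m m" using B C by auto
  have B': "- B \<in> carrier_mat n m" using B by simp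
  have carriers: "X \<in> carrier_mat (n + m) (n + m)" "Y \<in> carrier_mat (n + m) (n + m)"
    "T \<in> carrier_mat (n + m) (n + m)" "T' \<in> carrier_mat (n + m) (n + m)"
    using BC CB unfolding X_def Y_def T_def T'_def by auto
  have cancel: "B + - B = 0\<^sub>m n m" "- B + B = 0\<^sub>m n m"
    using B by (auto intro!: eq_matI)
  have TT': "T * T' = 1\<^sub>m (n + m)"
    unfolding T_def T'_def
      mult_four_block_mat[OF one_carrier_mat B zero_carrier_mat one_carrier_mat
        one_carrier_mat B' zero_carrier_mat one_carrier_mat] left_mult_zero_mat[OF B']
    using B B' cancel by simp
  have T'T: "T' * T = 1\<^sub>m (n + m)"
    using mat_mult_left_right_inverse[OF carriers(3,4) TT'] .
  have "X * T = four_block_mat (B * C) (B * C * B) C (C * B)"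
    unfolding X_def T_def
      mult_four_block_mat[OF BC zero_carrier_mat C zero_carrier_mat
        one_carrier_mat B zero_carrier_mat one_carrier_mat]
    using B C BC CB mult_carrier_mat[OF BC B] by simp
  also have "\<dots> = T * Y"
    unfolding Y_def T_def
      mult_four_block_mat[OF one_carrier_mat B zero_carrier_mat one_carrier_mat
        zero_carrier_mat zero_carrier_mat C CB]
    using B C BC CB mult_carrier_mat[OF B CB] assoc_mult_mat[OF B C B] by simp
  finally have XT: "X * T = T * Y" .
  have "X = X * (T * T')" using TT' carriers by simp
  also have "\<dots> = T * Y * T'"
    unfolding assoc_mult_mat[OF carriers(1,3,4), symmetric] XT ..
  finally have "X = T * Y * T'" .
  then have "similar_mat X Y"
    using carriers TT' T'T by (intro similar_matI[of X Y T T' "n + m"]) auto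
  then have "eigenvalues_mset X = eigenvalues_mset Y" by (rule eigenvalues_mset_similar)
  then show ?thesis
    unfolding X_def Y_def
    using eigenvalues_mset_lower_block[OF BC C zero_carrier_mat] eigenvalues_mset_lower_block[OF zero_carrier_mat C CB]
    by (simp add: eigenvalues_mset_zero add.commute)
qed

lemma similar_mat_unitary:
  fixes U :: "complex mat"
  assumes U: "U \<in> carrier_mat n n" "mat_adjoint U * U = 1\<^sub>m n" and A: "A \<in> carrier_mat n n"
  shows "similar_mat A (mat_adjoint U * A * U)"
proof -
  note U' = mat_adjoint_carrier[OF U(1)]
  have "U * mat_adjoint U = 1\<^sub>m n"
    by (rule mat_mult_left_right_inverse[OF U' U])
  moreover have "mat_adjoint U * A * U \<in> carrier_mat n n"
    by (rule mult_carrier_mat[OF mult_carrier_mat[OF U' A] U(1)])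
  ultimately show ?thesis
    using U U' A mult_unitary_conj_cancel[OF U A]
    by (intro similar_matI[of _ _ U "mat_adjoint U" n]) auto
qed

text \<open>A unitary that diagonalises \<open>H\<close> turns the hypothesis into
  \<open>D * Y = 1\<^sub>m n\<close> with \<open>D\<close> diagonal, which can be solved entry by
  entry. Reading both spectra off the same diagonal index set keeps the multiplicities.\<close>

lemma eigenvalues_mset_resolvent:
  assumes H: "H \<in> carrier_mat n n" "hermitian_mat H" and X: "X \<in> carrier_mat n n"
    and inv: "(1\<^sub>m n - H) * X = 1\<^sub>m n"
  shows "eigenvalues_mset X = image_mset (\<lambda>z. 1 / (1 - z)) (eigenvalues_mset H)"
proof -
  obtain U d where U: "U \<in> carrier_mat n n" "mat_adjoint U * U = 1\<^sub>m n"
    and UH: "mat_adjoint U * H * U = mat_diag n (\<lambda>i. complex_of_real (d i))"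
    using hermitian_spectral[OF H] by blast
  note U' = mat_adjoint_carrier[OF U(1)]
  have UU: "U * mat_adjoint U = 1\<^sub>m n" by (rule mat_mult_left_right_inverse[OF U' U])
  define Y where "Y = mat_adjoint U * X * U"
  have Y: "Y \<in> carrier_mat n n"
    unfolding Y_def by (rule mult_carrier_mat[OF mult_carrier_mat[OF U' X] U(1)])
  define D where "D = mat_diag n (\<lambda>i. 1 - complex_of_real (d i))"
  have "mat_adjoint U * (1\<^sub>m n - H) * U = 1\<^sub>m n - mat_diag n (\<lambda>i. complex_of_real (d i))"
    using sandwich_minus[OF U(1) U' one_carrier_mat H(1)] U UH by simp
  also have "\<dots> = D" by (rule eq_matI) (auto simp: D_def mat_diag_def)
  finally have "D * Y = mat_adjoint U * ((1\<^sub>m n - H) * X) * U"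
    unfolding Y_def using sandwich_mult[OF U(1) U' UU minus_carrier_mat[OF H(1)] X] by metis
  then have DY: "D * Y = 1\<^sub>m n" using inv U by simp
  have entry: "(1 - complex_of_real (d i)) * Y $$ (i, j) = (if i = j then 1 else 0)" if "i < n" "j < n" for i j
    using arg_cong[OF DY, of "\<lambda>Z. Z $$ (i, j)"] that
    unfolding D_def mat_diag_mult_left[OF Y] by simp
  have "Y = mat_diag n (\<lambda>i. 1 / (1 - complex_of_real (d i)))"
  proof (rule eq_matI)
    fix i j assume "i < dim_row (mat_diag n (\<lambda>i. 1 / (1 - complex_of_real (d i))))"
      "j < dim_col (mat_diag n (\<lambda>i. 1 / (1 - complex_of_real (d i))))"
    then have ij: "i < n" "j < n" by (auto simp: mat_diag_def)
    \<comment> \<open>The diagonal entry of the equation has right-hand side 1, so the hypothesis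
      itself excludes the eigenvalue 1 of \<open>H\<close>, and the division below is
      genuine.\<close>
    have "1 - complex_of_real (d i) \<noteq> 0" using entry[OF ij(1) ij(1)] by auto
    then have "Y $$ (i, j) = (if i = j then 1 else 0) / (1 - complex_of_real (d i))"
      using entry[OF ij] by (simp add: eq_divide_eq mult.commute)
    then show "Y $$ (i, j) = mat_diag n (\<lambda>i. 1 / (1 - complex_of_real (d i))) $$ (i, j)"
      using ij by (simp add: mat_diag_def)
  qed (use Y in \<open>auto simp: mat_diag_def\<close>)
  then have "eigenvalues_mset X = image_mset (\<lambda>i. 1 / (1 - complex_of_real (d i))) (mset_set {0..<n})"
    using eigenvalues_mset_similar[OF similar_mat_unitary[OF U X]]
    unfolding Y_def by (simp only: eigenvalues_mset_mat_diag)
  moreover have "eigenvalues_mset H = image_mset (\<lambda>i. complex_of_real (d i)) (mset_set {0..<n})"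
    using eigenvalues_mset_similar[OF similar_mat_unitary[OF U H(1)]]
    unfolding UH by (simp only: eigenvalues_mset_mat_diag)
  ultimately show ?thesis by (simp add: multiset.map_comp comp_def)
qed

section \<open>Gram matrices, rank and the multiplicity of the eigenvalue zero\<close>

lemma hermitian_gram:
  assumes M: "M \<in> carrier_mat m k"
  shows "hermitian_mat (mat_adjoint M * (M :: complex mat))"
  unfolding hermitian_mat_def using mat_adjoint_mult[OF mat_adjoint_carrier[OF M] M] by simp

text \<open>After diagonalisation the entries are squared norms of the columns of
  \<open>M * U\<close>, hence nonnegative. The same unitary diagonalises the identity minus the Gram
  matrix, whose entries \<open>1 - d i\<close> are positive. The real multiset \<open>D\<close> is
  what can later be sorted.\<close>

lemma eigenvalues_mset_gram:
  fixes M :: "complex mat"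
  assumes M: "M \<in> carrier_mat m k" and pd: "pos_def_mat (1\<^sub>m k - mat_adjoint M * M)"
  obtains D where "eigenvalues_mset (mat_adjoint M * M) = image_mset complex_of_real D"
    "\<And>x. x \<in># D \<Longrightarrow> 0 \<le> x \<and> x < 1"
proof -
  define G where "G = mat_adjoint M * M"
  note M' = mat_adjoint_carrier[OF M]
  have G: "G \<in> carrier_mat k k" unfolding G_def by (rule mult_carrier_mat[OF M' M])
  obtain U d where U: "U \<in> carrier_mat k k" "mat_adjoint U * U = 1\<^sub>m k"
    and UG: "mat_adjoint U * G * U = mat_diag k (\<lambda>i. complex_of_real (d i))"
    using hermitian_spectral[OF G] hermitian_gram[OF M] unfolding G_def by blast
  note U' = mat_adjoint_carrier[OF U(1)]
  have bounds: "0 \<le> d i \<and> d i < 1" if i: "i < k" for i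
  proof
    have "mat_adjoint U * G * U = mat_adjoint (M * U) * (M * U)"
      unfolding G_def mat_adjoint_mult[OF M U(1)] assoc_mult_mat[OF U' M' mult_carrier_mat[OF M U(1)]]
        assoc_mult_mat[OF U' mult_carrier_mat[OF M' M] U(1)] assoc_mult_mat[OF M' M U(1)] ..
    from arg_cong[OF this[unfolded UG], of "\<lambda>X. X $$ (i, i)"]
    have "complex_of_real (d i) = col (M * U) i \<bullet>c col (M * U) i"
      unfolding mat_adjoint_mult_self_index[OF mult_carrier_mat[OF M U(1)] i i]
      using i by (simp add: mat_diag_def)
    moreover have "col (M * U) i \<bullet>c col (M * U) i \<ge> 0" by (rule conjugate_square_ge_0_vec)
    ultimately have "complex_of_real (d i) \<ge> 0" by simp
    then show "0 \<le> d i" by (simp add: less_eq_complex_def)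
    have "pos_def_mat (mat_adjoint U * (1\<^sub>m k - G) * U)"
      unfolding G_def
      by (rule pos_def_mat_congruence_inverse[OF pd minus_carrier_mat[OF G[unfolded G_def]] U(1) U' U(2)])
    moreover have "mat_adjoint U * (1\<^sub>m k - G) * U = 1\<^sub>m k - mat_diag k (\<lambda>i. complex_of_real (d i))"
      using sandwich_minus[OF U(1) U' one_carrier_mat G] U UG by simp
    ultimately have "Re ((1\<^sub>m k - mat_diag k (\<lambda>i. complex_of_real (d i))) $$ (i, i)) > 0"
      using i by (intro pos_def_mat_diag_pos[of _ k]) (auto simp: mat_diag_def)
    then show "d i < 1" using i by (simp add: mat_diag_def)
  qed
  have "eigenvalues_mset G = image_mset complex_of_real (image_mset d (mset_set {0..<k}))"
    using eigenvalues_mset_similar[OF similar_mat_unitary[OF U G]]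
    unfolding UG eigenvalues_mset_mat_diag by (simp add: multiset.map_comp comp_def)
  then show ?thesis
    using bounds unfolding G_def by (intro that[of "image_mset d (mset_set {0..<k})"]) auto
qed

lemma count_eigenvalues_zero:
  assumes A: "(A :: complex mat) \<in> carrier_mat n n"
    and inj: "\<And>v. v \<in> carrier_vec n \<Longrightarrow> A *\<^sub>v v = 0\<^sub>v n \<Longrightarrow> v = 0\<^sub>v n"
  shows "count (eigenvalues_mset A) 0 = 0"
proof -
  have "0 \<cdot>\<^sub>v v = 0\<^sub>v n" if "v \<in> carrier_vec n" for v :: "complex vec"
    using that by (intro eq_vecI) auto
  then have "\<not> eigenvalue A 0"
    using A inj unfolding eigenvalue_def eigenvector_def by auto
  then have "poly (char_poly A) 0 \<noteq> 0" using eigenvalue_root_char_poly[OF A] by blast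
  then show ?thesis
    unfolding eigenvalues_mset_def count_proots[OF char_poly_nonzero[OF A]] by (simp add: order_0I)
qed

text \<open>The Gram form at \<open>v\<close> is the squared norm of \<open>M *\<^sub>v v\<close>,
  so the Gram matrix has the kernel of \<open>M\<close>.\<close>

lemma gram_mult_vec_inj:
  fixes M :: "complex mat"
  assumes M: "M \<in> carrier_mat m k"
    and inj: "\<And>v. v \<in> carrier_vec k \<Longrightarrow> M *\<^sub>v v = 0\<^sub>v m \<Longrightarrow> v = 0\<^sub>v k"
    and v: "v \<in> carrier_vec k" "(mat_adjoint M * M) *\<^sub>v v = 0\<^sub>v k"
  shows "v = 0\<^sub>v k"
proof -
  note M' = mat_adjoint_carrier[OF M]
  have Mv: "M *\<^sub>v v \<in> carrier_vec m" using M v by simp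
  have "mat_adjoint M *\<^sub>v (M *\<^sub>v v) = 0\<^sub>v k"
    using assoc_mult_mat_vec[OF M' M v(1)] v(2) by simp
  then have "(M *\<^sub>v v) \<bullet>c (M *\<^sub>v v) = 0"
    using mat_adjoint_scalar_prod[OF M v(1) Mv] v(1) by simp
  then have "M *\<^sub>v v = 0\<^sub>v m" using conjugate_square_eq_0_vec[OF Mv] by blast
  then show ?thesis by (rule inj[OF v(1)])
qed

lemma rank_obtain_indpt_cols:
  assumes M: "(M :: complex mat) \<in> carrier_mat m k"
  obtains S where "S \<subseteq> set (cols M)" "card S = vec_space.rank m M" "\<not> module.lin_dep class_ring (module_vec TYPE(complex) m) S"
proof -
  interpret vec_space "TYPE(complex)" m .
  obtain S where S: "maximal S (\<lambda>T. T \<subseteq> set (cols M) \<and> lin_indpt T)"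
    using maximal_exists_superset[of "set (cols M)" "\<lambda>T. T \<subseteq> set (cols M) \<and> lin_indpt T" "{}"]
    by (auto simp: finite_lin_indpt2)
  then have "S \<subseteq> set (cols M)" "lin_indpt S" unfolding maximal_def by auto
  then show ?thesis using that[of S] rank_card_indpt[OF M S] by simp
qed

text \<open>Linear dependence is a property of the set of columns, in which equal columns collapse.
  Rank \<open>k\<close> forces \<open>k\<close> different columns, and only then is a nonzero kernel
  vector a dependency of that set.\<close>

lemma full_col_rank_inj:
  fixes M :: "complex mat"
  assumes M: "M \<in> carrier_mat m k" and rank: "vec_space.rank m M = k"
    and v: "v \<in> carrier_vec k" "M *\<^sub>v v = 0\<^sub>v m"
  shows "v = 0\<^sub>v k"
proof -
  interpret vec_space "TYPE(complex)" m .
  obtain S where "S \<subseteq> set (cols M)" "card S = k" using rank_obtain_indpt_cols[OF M] rank by metis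
  then have "k \<le> card (set (cols M))" by (metis List.finite_set card_mono)
  then have "distinct (cols M)" using M card_length[of "cols M"] by (intro card_distinct) auto
  then show ?thesis
    using full_rank_lin_indpt[OF M rank] lin_depI[OF M v(1) _ v(2)] by blast
qed

text \<open>Choose \<open>m\<close> independent columns; they form an invertible square matrix
  \<open>K\<close>. A vector killed by the adjoint of \<open>M\<close> is killed by the adjoint of
  \<open>K\<close>, which is invertible too.\<close>

lemma full_row_rank_adjoint_inj:
  fixes M :: "complex mat"
  assumes M: "M \<in> carrier_mat m k" and rank: "vec_space.rank m M = m"
    and w: "w \<in> carrier_vec m" "mat_adjoint M *\<^sub>v w = 0\<^sub>v k"
  shows "w = 0\<^sub>v m"
proof -
  interpret vec_space "TYPE(complex)" m .
  obtain S where S: "S \<subseteq> set (cols M)" "card S = m" "lin_indpt S"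
    using rank_obtain_indpt_cols[OF M] rank by metis
  then have "finite S" by (meson List.finite_set finite_subset)
  then obtain ss where ss: "set ss = S" "distinct ss" using finite_distinct_list by blast
  define K where "K = mat_of_cols m ss"
  have len: "length ss = m" using ss S distinct_card by metis
  have "set (cols M) \<subseteq> carrier_vec m" using M cols_dim by blast
  then have ss_carrier: "set ss \<subseteq> carrier_vec m" using S ss by blast
  have K: "K \<in> carrier_mat m m" unfolding K_def using len by auto
  have cols: "cols K = ss" unfolding K_def using ss_carrier by simp
  have "vec_space.rank m K = m" by (rule lin_indpt_full_rank[OF K]) (use cols ss S in auto)
  then have inj: "\<And>v. v \<in> carrier_vec m \<Longrightarrow> K *\<^sub>v v = 0\<^sub>v m \<Longrightarrow> v = 0\<^sub>v m"
    using full_col_rank_inj[OF K] by blast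
  note inv = mat_inv_invertible[OF K inj]
  have "mat_adjoint (mat_inv K) * mat_adjoint K = 1\<^sub>m m"
    using mat_adjoint_mult[OF K inv(1)] inv(2) by simp
  moreover have "mat_adjoint K *\<^sub>v w = 0\<^sub>v m"
  proof (rule eq_vecI)
    fix i assume "i < dim_vec (0\<^sub>v m :: complex vec)"
    then have i: "i < m" by simp
    have "ss ! i \<in> set (cols M)" using i len ss S by (metis nth_mem subsetD)
    then obtain j where j: "j < k" "ss ! i = col M j"
      using M by (metis carrier_matD(2) cols_length cols_nth in_set_conv_nth)
    have "ss ! i \<in> carrier_vec m" using ss_carrier i len by auto
    \<comment> \<open>Column \<open>i\<close> of \<open>K\<close> is column \<open>j\<close> of
      \<open>M\<close>, so the corresponding rows of the adjoints agree.\<close>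
    then have "(mat_adjoint K *\<^sub>v w) $ i = (mat_adjoint M *\<^sub>v w) $ j"
      using i j M K w(1) len
      by (auto simp: scalar_prod_def K_def mat_of_cols_index intro!: sum.cong)
    then show "(mat_adjoint K *\<^sub>v w) $ i = 0\<^sub>v m $ i" using w(2) i j by simp
  qed (use K in simp)
  ultimately show ?thesis
    using left_inverse_mult_vec_inj[OF mat_adjoint_carrier[OF K] mat_adjoint_carrier[OF inv(1)] _ w(1)] by blast
qed

text \<open>Whichever Gram matrix is the smaller one is injective under full rank. For n > q this is
  the q x q one, and exchanging the factors adds exactly n - q zeros.\<close>

lemma full_rank_count_zero:
  assumes R: "R \<in> carrier_mat n q" and rank: "full_rank R"
  shows "count (eigenvalues_mset (R * mat_adjoint R)) 0 = n - min n q"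
proof -
  note R' = mat_adjoint_carrier[OF R]
  have rank: "vec_space.rank n R = min n q" using rank R unfolding full_rank_def by simp
  show ?thesis
  proof (cases "n \<le> q")
    case True
    then have rank: "vec_space.rank n R = n" using rank by simp
    note inj = gram_mult_vec_inj[OF R' full_row_rank_adjoint_inj[OF R rank], unfolded mat_adjoint_adjoint]
    have "count (eigenvalues_mset (R * mat_adjoint R)) 0 = 0"
      by (rule count_eigenvalues_zero[OF mult_carrier_mat[OF R R'] inj])
    then show ?thesis using True by simp
  next
    case False
    then have rank: "vec_space.rank n R = q" using rank by simp
    note inj = gram_mult_vec_inj[OF R full_col_rank_inj[OF R rank]]
    have "count (eigenvalues_mset (mat_adjoint R * R)) 0 = 0"
      by (rule count_eigenvalues_zero[OF mult_carrier_mat[OF R' R] inj])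
    then show ?thesis
      using arg_cong[OF eigenvalues_mset_mult_commute[OF R R'], of "\<lambda>E. count E 0"] False by simp
  qed
qed

section \<open>Sorted lists of padded multisets\<close>

lemma sorted_list_of_multiset_add_replicate_least:
  assumes "\<And>x. x \<in># F \<Longrightarrow> (a :: 'a :: linorder) \<le> x"
  shows "sorted_list_of_multiset (F + replicate_mset k a) = replicate k a @ sorted_list_of_multiset F"
proof -
  obtain xs where xs: "F = mset xs" by (metis ex_mset)
  have "sorted_list_of_multiset (mset (replicate k a @ xs)) = replicate k a @ sort xs"
    unfolding sorted_list_of_multiset_mset
    by (rule sort_append_replicate_left) (use assms xs in auto)
  then show ?thesis by (simp add: xs add.commute)
qed

text \<open>Passes from 0-based list positions to the 1-based counting of
  \<open>singular_value\<close>.\<close>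

lemma mset_take_conv_image:
  assumes "r \<le> length L"
  shows "mset (take r L) = image_mset (\<lambda>i. L ! (i - 1)) (mset_set {1..r})"
proof -
  have "take r L = map (\<lambda>i. L ! i) [0..<r]"
    using assms by (intro nth_equalityI) auto
  then have "mset (take r L) = image_mset (\<lambda>i. L ! i) (mset_set {0..<r})"
    by (metis mset_map mset_upt)
  also have "\<dots> = image_mset (\<lambda>i. L ! (i - 1)) (image_mset Suc (mset_set {0..<r}))"
    by (simp add: multiset.map_comp comp_def)
  also have "image_mset Suc (mset_set {0..<r}) = mset_set {1..r}"
    by (simp add: image_mset_mset_set image_Suc_atLeastLessThan atLeastLessThanSuc_atLeastAtMost)
  finally show ?thesis .
qed

text \<open>\<open>E\<close> and \<open>D\<close> stand for the spectra of
  \<open>R * mat_adjoint R\<close> and \<open>mat_adjoint R * R\<close>. For q \<le> n the whole of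
  \<open>D\<close> is taken and zeros are added. For q > n the multiset \<open>D\<close> is
  \<open>E\<close> with q - n further zeros, which are its least elements and so are cut off by
  \<open>take\<close>.\<close>

lemma multiset_largest_of_padded:
  fixes E :: "complex multiset" and D :: "real multiset"
  assumes eq: "E + replicate_mset q 0 = image_mset complex_of_real D + replicate_mset n 0"
    and sizes: "size E = n" "size D = q" and nonneg: "\<And>x. x \<in># D \<Longrightarrow> 0 \<le> x"
  shows "E = image_mset complex_of_real (mset (take (min n q) (rev (sorted_list_of_multiset D))))
    + replicate_mset (n - min n q) 0"
proof (cases "q \<le> n")
  case True
  have "replicate_mset n (0::complex) = replicate_mset (n - q) 0 + replicate_mset q 0"
    using True by (simp add: multiset_eq_iff)
  then have "E = image_mset complex_of_real D + replicate_mset (n - q) 0"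
    using eq by (simp add: add.assoc[symmetric])
  moreover have "length (sorted_list_of_multiset D) = q"
    using sizes(2) by (metis mset_sorted_list_of_multiset size_mset)
  ultimately show ?thesis using True by (simp add: min_absorb2)
next
  case False
  define k where "k = q - n"
  have "replicate_mset q (0::complex) = replicate_mset k 0 + replicate_mset n 0"
    using False by (simp add: multiset_eq_iff k_def)
  then have E: "image_mset complex_of_real D = E + replicate_mset k 0"
    using eq by (simp add: add.assoc[symmetric])
  \<comment> \<open>\<open>E\<close> is only known as a complex multiset. That it is real follows
    because it sits inside the image of \<open>D\<close>; \<open>F\<close> is its real form, needed
    for sorting.\<close>
  define F where "F = image_mset Re E"
  have "image_mset Re (image_mset complex_of_real D) = F + replicate_mset k 0"
    unfolding E F_def by simp
  then have D: "D = F + replicate_mset k 0" by (simp add: multiset.map_comp comp_def)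
  have "image_mset complex_of_real F + replicate_mset k 0 = E + replicate_mset k 0"
    using E unfolding D by simp
  then have EF: "E = image_mset complex_of_real F" by simp
  have "rev (sorted_list_of_multiset D) = rev (sorted_list_of_multiset F) @ replicate k 0"
    unfolding D using nonneg D by (subst sorted_list_of_multiset_add_replicate_least) auto
  moreover have "length (sorted_list_of_multiset F) = n"
    using sizes(1) by (metis F_def mset_sorted_list_of_multiset size_image_mset size_mset)
  ultimately show ?thesis using False by (simp add: EF)
qed

section \<open>Resolvent identities and inversion of the block matrix\<close>

lemma mult_uminus_right_mat:
  fixes A :: "'a :: ring mat"
  assumes "A \<in> carrier_mat m k" "B \<in> carrier_mat k l"
  shows "A * - B = - (A * B)"
  using assms by (intro uminus_mult_right_mat) auto

lemma mult_mat_assoc_eq: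
  fixes A :: "'a :: semiring_0 mat"
  assumes "A * B = C" "A \<in> carrier_mat m k" "B \<in> carrier_mat k l" "Z \<in> carrier_mat l p"
  shows "A * (B * Z) = C * Z"
  using assoc_mult_mat[OF assms(2-4)] assms(1) by simp

text \<open>The equation \<open>inv\<close> multiplied by \<open>Z\<close> and expanded, bracketed
  as the block products below produce it.\<close>

lemma resolvent_mult:
  fixes Q :: "'a :: ring_1 mat"
  assumes Q: "Q \<in> carrier_mat m k" and R: "R \<in> carrier_mat k m" and Y: "Y \<in> carrier_mat m m"
    and inv: "(1\<^sub>m m - Q * R) * Y = 1\<^sub>m m" and Z: "Z \<in> carrier_mat m l"
  shows "Y * Z - Q * (R * (Y * Z)) = Z"
proof -
  have YZ: "Y * Z \<in> carrier_mat m l" using Y Z by simp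
  have QR: "Q * R \<in> carrier_mat m m" using Q R by simp
  have "Z = (1\<^sub>m m - Q * R) * (Y * Z)"
    using mult_mat_assoc_eq[OF inv minus_carrier_mat[OF QR] Y Z] Z by simp
  also have "\<dots> = Y * Z - Q * R * (Y * Z)"
    using minus_mult_distrib_mat[OF one_carrier_mat QR YZ] left_mult_one_mat[OF YZ] by simp
  finally show ?thesis using assoc_mult_mat[OF Q R YZ] by simp
qed

text \<open>The push-through identity. With \<open>Z = R * (Y * Q)\<close>, multiplying
  \<open>Y * Q - Q * Z = Q\<close> by \<open>R\<close> gives \<open>R * Q + R * (Q * Z) = Z\<close>,
  exactly what cancels when the product is expanded.\<close>

lemma resolvent_swap:
  fixes Q :: "'a :: ring_1 mat"
  assumes Q: "Q \<in> carrier_mat m k" and R: "R \<in> carrier_mat k m" and Y: "Y \<in> carrier_mat m m"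
    and inv: "(1\<^sub>m m - Q * R) * Y = 1\<^sub>m m"
  shows "(1\<^sub>m k - R * Q) * (1\<^sub>m k + R * (Y * Q)) = 1\<^sub>m k"
proof -
  define Z where "Z = R * (Y * Q)"
  have YQ: "Y * Q \<in> carrier_mat m k" by (rule mult_carrier_mat[OF Y Q])
  have Z: "Z \<in> carrier_mat k k" unfolding Z_def by (rule mult_carrier_mat[OF R YQ])
  have RQ: "R * Q \<in> carrier_mat k k" by (rule mult_carrier_mat[OF R Q])
  have QZ: "Q * Z \<in> carrier_mat m k" by (rule mult_carrier_mat[OF Q Z])
  have RQZ: "R * (Q * Z) \<in> carrier_mat k k" by (rule mult_carrier_mat[OF R QZ])
  have "Y * Q - Q * Z = Q"
    unfolding Z_def by (rule resolvent_mult[OF Q R Y inv Q])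
  then have "R * Q = R * (Y * Q - Q * Z)" by (rule arg_cong[OF sym])
  also have "\<dots> = R * (Y * Q) - R * (Q * Z)" by (rule mult_minus_distrib_mat[OF R YQ QZ])
  also have "R * (Y * Q) = Z" unfolding Z_def ..
  finally have "R * Q = Z - R * (Q * Z)" .
  moreover have "M - K + K = M" if "M \<in> carrier_mat k k" "K \<in> carrier_mat k k" for M K :: "'a mat"
    using that by (intro eq_matI) auto
  ultimately have sum: "R * Q + R * (Q * Z) = Z" using Z RQZ by metis
  have "(1\<^sub>m k - R * Q) * (1\<^sub>m k + Z) = (1\<^sub>m k + Z) - R * Q * (1\<^sub>m k + Z)"
    using minus_mult_distrib_mat[OF one_carrier_mat RQ add_carrier_mat[OF Z]]
      left_mult_one_mat[OF add_carrier_mat[OF Z]] by simp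
  also have "R * Q * (1\<^sub>m k + Z) = Z"
    unfolding mult_add_distrib_mat[OF RQ one_carrier_mat Z] assoc_mult_mat[OF R Q Z]
      right_mult_one_mat[OF RQ] by (rule sum)
  also have "(1\<^sub>m k + Z) - Z = 1\<^sub>m k"
    using Z by (intro eq_matI) auto
  finally show ?thesis unfolding Z_def .
qed

text \<open>The hypotheses say that, with \<open>T\<close> and \<open>W\<close> the inverse square roots of the diagonal blocks,
  the block matrix is \<open>diag(S, V) [[1, R], [Q, 1]] diag(S, V)\<close>.\<close>

locale whitened_blocks =
  fixes n q :: nat and A11 A12 A21 A22 S T V W R Q :: "complex mat"
  assumes carriers: "A11 \<in> carrier_mat n n" "A12 \<in> carrier_mat n q" "A21 \<in> carrier_mat q n" "A22 \<in> carrier_mat q q"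
    "S \<in> carrier_mat n n" "T \<in> carrier_mat n n" "V \<in> carrier_mat q q" "W \<in> carrier_mat q q"
    "R \<in> carrier_mat n q" "Q \<in> carrier_mat q n"
    and whiten: "A11 * T = S" "A12 * W = S * R" "A21 * T = V * Q" "A22 * W = V"
    and inverses: "S * T = 1\<^sub>m n" "T * S = 1\<^sub>m n" "V * W = 1\<^sub>m q" "W * V = 1\<^sub>m q"
begin

abbreviation "A \<equiv> four_block_mat A11 A12 A21 A22"

text \<open>Between two factors diag(T, W) stands [[X, - R Y], [- Q X, Y]], the inverse of [[1, R],
  [Q, 1]]. Writing the corner as - R Y, and not as the equal - X R, keeps one resolvent per column,
  so the off-diagonal products cancel at once.\<close>

lemma inverse_blocks:
  assumes X: "X \<in> carrier_mat n n" "(1\<^sub>m n - R * Q) * X = 1\<^sub>m n"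
    and Y: "Y \<in> carrier_mat q q" "(1\<^sub>m q - Q * R) * Y = 1\<^sub>m q"
  shows "A * four_block_mat (T * (X * T)) (- (T * (R * (Y * W)))) (- (W * (Q * (X * T)))) (W * (Y * W)) = 1\<^sub>m (n + q)"
proof -
  note c = carriers
  have XT: "X * T \<in> carrier_mat n n" by (rule mult_carrier_mat[OF X(1) c(6)])
  have YW: "Y * W \<in> carrier_mat q q" by (rule mult_carrier_mat[OF Y(1) c(8)])
  have QXT: "Q * (X * T) \<in> carrier_mat q n" by (rule mult_carrier_mat[OF c(10) XT])
  have RYW: "R * (Y * W) \<in> carrier_mat n q" by (rule mult_carrier_mat[OF c(9) YW])
  have B11: "T * (X * T) \<in> carrier_mat n n" by (rule mult_carrier_mat[OF c(6) XT])
  have B12: "T * (R * (Y * W)) \<in> carrier_mat n q" by (rule mult_carrier_mat[OF c(6) RYW])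
  have B21: "W * (Q * (X * T)) \<in> carrier_mat q n" by (rule mult_carrier_mat[OF c(8) QXT])
  have B22: "W * (Y * W) \<in> carrier_mat q q" by (rule mult_carrier_mat[OF c(8) YW])
  have cancel: "M + - M = 0\<^sub>m k l" "- M + M = 0\<^sub>m k l" if "M \<in> carrier_mat k l" for M :: "complex mat" and k l
    using that by (auto intro!: eq_matI)
  have "A11 * (T * (X * T)) + A12 * (- (W * (Q * (X * T)))) = S * (X * T) - S * (R * (Q * (X * T)))"
    using mult_mat_assoc_eq[OF whiten(1) c(1,6) XT] mult_mat_assoc_eq[OF whiten(2) c(2,8) QXT]
      assoc_mult_mat[OF c(5,9) QXT] minus_add_uminus_mat[OF mult_carrier_mat[OF c(5) XT]
        mult_carrier_mat[OF c(5) mult_carrier_mat[OF c(9) QXT]]] mult_uminus_right_mat[OF c(2) B21]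
    by simp
  also have "\<dots> = S * (X * T - R * (Q * (X * T)))"
    using mult_minus_distrib_mat[OF c(5) XT mult_carrier_mat[OF c(9) QXT]] by simp
  also have "\<dots> = 1\<^sub>m n"
    unfolding resolvent_mult[OF c(9,10) X c(6)] by (rule inverses(1))
  finally have UL: "A11 * (T * (X * T)) + A12 * (- (W * (Q * (X * T)))) = 1\<^sub>m n" .
  have UR: "A11 * (- (T * (R * (Y * W)))) + A12 * (W * (Y * W)) = 0\<^sub>m n q"
    using mult_mat_assoc_eq[OF whiten(1) c(1,6) RYW] mult_mat_assoc_eq[OF whiten(2) c(2,8) YW]
      assoc_mult_mat[OF c(5,9) YW] cancel(2)[OF mult_carrier_mat[OF c(5) RYW]] mult_uminus_right_mat[OF c(1) B12]
    by simp
  have LL: "A21 * (T * (X * T)) + A22 * (- (W * (Q * (X * T)))) = 0\<^sub>m q n"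
    using mult_mat_assoc_eq[OF whiten(3) c(3,6) XT] mult_mat_assoc_eq[OF whiten(4) c(4,8) QXT]
      assoc_mult_mat[OF c(7,10) XT] cancel(1)[OF mult_carrier_mat[OF c(7) QXT]] mult_uminus_right_mat[OF c(4) B21]
    by simp
  have "A21 * (- (T * (R * (Y * W)))) + A22 * (W * (Y * W)) = - (V * (Q * (R * (Y * W)))) + V * (Y * W)"
    using mult_mat_assoc_eq[OF whiten(3) c(3,6) RYW] mult_mat_assoc_eq[OF whiten(4) c(4,8) YW]
      assoc_mult_mat[OF c(7,10) RYW] mult_uminus_right_mat[OF c(3) B12]
    by simp
  also have "\<dots> = V * (Y * W) - V * (Q * (R * (Y * W)))"
    using mult_carrier_mat[OF c(7) YW] mult_carrier_mat[OF c(7) mult_carrier_mat[OF c(10) RYW]]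
    by (intro eq_matI) auto
  also have "\<dots> = V * (Y * W - Q * (R * (Y * W)))"
    using mult_minus_distrib_mat[OF c(7) YW mult_carrier_mat[OF c(10) RYW]] by simp
  also have "\<dots> = 1\<^sub>m q"
    unfolding resolvent_mult[OF c(10,9) Y c(8)] by (rule inverses(3))
  finally have LR: "A21 * (- (T * (R * (Y * W)))) + A22 * (W * (Y * W)) = 1\<^sub>m q" .
  show ?thesis
    unfolding mult_four_block_mat[OF c(1-4) B11 uminus_carrier_mat[OF B12] uminus_carrier_mat[OF B21] B22]
      UL UR LL LR by (rule four_block_one_mat)
qed

text \<open>Congruence by \<open>C\<close> = diag(T, W) [[1, - R], [0, 1]] whitens the diagonal
  blocks and then eliminates \<open>R\<close>. The result is positive definite with lower-right
  block \<open>1\<^sub>m q - Q * R\<close>. Its inverse \<open>C'\<close> is [[1, R], [0, 1]]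
  diag(S, V).\<close>

lemma pos_def_schur_complement:
  assumes pd: "pos_def_mat A" and adj: "mat_adjoint T = T" "mat_adjoint W = W" "Q = mat_adjoint R"
  shows "pos_def_mat (1\<^sub>m q - Q * R)"
proof -
  note c = carriers
  have TR: "T * R \<in> carrier_mat n q" by (rule mult_carrier_mat[OF c(6,9)])
  have TR': "- (T * R) \<in> carrier_mat n q" using TR by simp
  have QR: "Q * R \<in> carrier_mat q q" by (rule mult_carrier_mat[OF c(10,9)])
  define C where "C = four_block_mat T (- (T * R)) (0\<^sub>m q n) W"
  define C' where "C' = four_block_mat S (R * V) (0\<^sub>m q n) V"
  have RV: "R * V \<in> carrier_mat n q" by (rule mult_carrier_mat[OF c(9,7)])
  have C: "C \<in> carrier_mat (n + q) (n + q)" "C' \<in> carrier_mat (n + q) (n + q)"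
    unfolding C_def C'_def using c by auto
  have cancel: "- M + M = 0\<^sub>m k l" if "M \<in> carrier_mat k l" for M :: "complex mat" and k l
    using that by (auto intro!: eq_matI)
  have STR: "S * (T * R) = R" by (rule mult_mat_inverse_cancel[OF inverses(1) c(5,6,9)])
  have RVW: "R * V * W = R" using assoc_mult_mat[OF c(9,7,8)] inverses(3) c(9) by simp
  have "C' * C = 1\<^sub>m (n + q)"
    unfolding C_def C'_def
      mult_four_block_mat[OF c(5) RV zero_carrier_mat c(7) c(6) TR' zero_carrier_mat c(8)]
    using STR RVW inverses c RV mult_uminus_right_mat[OF c(5) TR] cancel[OF c(9)] left_mult_zero_mat[OF TR', of q] by simp
  then have pdC: "pos_def_mat (mat_adjoint C * A * C)"
    using pos_def_mat_congruence_inverse[OF pd _ C(1) C(2)] c by simp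
  let ?c = "mat_adjoint (- (T * R))"
  have TR'_adj: "?c \<in> carrier_mat q n" using TR' by (rule mat_adjoint_carrier)
  have zero: "mat_adjoint (0\<^sub>m q n) = (0\<^sub>m n q :: complex mat)" by (rule eq_matI) auto
  have adjC: "mat_adjoint C = four_block_mat T (0\<^sub>m n q) ?c W"
    unfolding C_def mat_adjoint_four_block_mat[OF c(6) TR' zero_carrier_mat c(8)] adj zero ..
  \<comment> \<open>Only the lower-right block of the congruent matrix is read off, so the first
    column stays unevaluated.\<close>
  let ?u = "A11 * T + A12 * 0\<^sub>m q n" and ?l = "A21 * T + A22 * 0\<^sub>m q n"
  have u: "?u \<in> carrier_mat n n" and l: "?l \<in> carrier_mat q n" using c by simp_all
  have "A11 * (- (T * R)) + A12 * W = 0\<^sub>m n q"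
    using mult_mat_assoc_eq[OF whiten(1) c(1,6,9)] whiten(2) mult_uminus_right_mat[OF c(1) TR]
      cancel[OF mult_carrier_mat[OF c(5,9)]] by simp
  moreover have "A21 * (- (T * R)) + A22 * W = V * (1\<^sub>m q - Q * R)"
  proof -
    have VQR: "V * (Q * R) \<in> carrier_mat q q" by (rule mult_carrier_mat[OF c(7) QR])
    have "A21 * (- (T * R)) + A22 * W = - (V * (Q * R)) + V"
      using mult_mat_assoc_eq[OF whiten(3) c(3,6,9)] assoc_mult_mat[OF c(7,10,9)] whiten(4) mult_uminus_right_mat[OF c(3) TR] by simp
    also have "\<dots> = V - V * (Q * R)" using VQR c(7) by (intro eq_matI) auto
    also have "\<dots> = V * (1\<^sub>m q - Q * R)"
      using mult_minus_distrib_mat[OF c(7) one_carrier_mat QR] c(7) by simp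
    finally show ?thesis .
  qed
  ultimately have AC: "A * C = four_block_mat ?u (0\<^sub>m n q) ?l (V * (1\<^sub>m q - Q * R))"
    unfolding C_def mult_four_block_mat[OF c(1-4) c(6) TR' zero_carrier_mat c(8)] by simp
  have F: "1\<^sub>m q - Q * R \<in> carrier_mat q q" by (rule minus_carrier_mat[OF QR])
  have VF: "V * (1\<^sub>m q - Q * R) \<in> carrier_mat q q" by (rule mult_carrier_mat[OF c(7) F])
  have A: "A \<in> carrier_mat (n + q) (n + q)" using c by auto
  have "mat_adjoint C * A * C = mat_adjoint C * (A * C)"
    by (rule assoc_mult_mat[OF mat_adjoint_carrier[OF C(1)] A C(1)])
  also have "\<dots> = four_block_mat (T * ?u + 0\<^sub>m n q * ?l) (T * 0\<^sub>m n q + 0\<^sub>m n q * (V * (1\<^sub>m q - Q * R)))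
     (?c * ?u + W * ?l) (?c * 0\<^sub>m n q + W * (V * (1\<^sub>m q - Q * R)))"
    unfolding AC adjC
    by (rule mult_four_block_mat[OF c(6) zero_carrier_mat TR'_adj c(8) u zero_carrier_mat l VF])
  also have "?c * 0\<^sub>m n q + W * (V * (1\<^sub>m q - Q * R)) = 1\<^sub>m q - Q * R"
    using mult_mat_inverse_cancel[OF inverses(4) c(8,7) F] right_mult_zero_mat[OF TR'_adj, of q] F by simp
  finally have "pos_def_mat (four_block_mat (T * ?u + 0\<^sub>m n q * ?l) (T * 0\<^sub>m n q + 0\<^sub>m n q * (V * (1\<^sub>m q - Q * R)))
     (?c * ?u + W * ?l) (1\<^sub>m q - Q * R))"
    using pdC by metis
  then show ?thesis
    by (rule pos_def_mat_four_block(2)[where n = n and m = q])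
      (intro add_carrier_mat mult_carrier_mat[OF c(6)] mult_carrier_mat[OF c(8)]
        mult_carrier_mat[OF zero_carrier_mat] zero_carrier_mat l VF F)+
qed

end


section \<open>Spectra of the two complementary products and the final claims\<close>

text \<open>With \<open>A11 = S * S\<close> and upper-left inverse block \<open>T * (X * T)\<close>,
  where \<open>T\<close> inverts \<open>S\<close>, the corner product is \<open>S * X * T\<close>, a
  conjugate of \<open>X\<close>. The other corner gives \<open>V * Y * W\<close> in the same
  way.\<close>

theorem upper_left_eigenvalues:
  fixes A A11 A12 A22 R P :: "complex mat"
  assumes pd: "pos_def_mat A" and A11: "A11 \<in> carrier_mat n n" and A12: "A12 \<in> carrier_mat n q"
    and A22: "A22 \<in> carrier_mat q q"
    and A: "A = four_block_mat A11 A12 (mat_adjoint A12) A22"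
    and R_def: "R = pd_inv_sqrt A11 * A12 * pd_inv_sqrt A22"
  shows "pos_def_mat (1\<^sub>m q - mat_adjoint R * R)"
    "eigenvalues_mset (upper_left n A * upper_left n (mat_inv A)) =
      image_mset (\<lambda>z. 1 / (1 - z)) (eigenvalues_mset (R * mat_adjoint R))"
    "eigenvalues_mset (A22 * lower_right q (mat_inv A)) =
      image_mset (\<lambda>z. 1 / (1 - z)) (eigenvalues_mset (mat_adjoint R * R))"
proof -
  note A12' = mat_adjoint_carrier[OF A12]
  note pd_blocks = pos_def_mat_four_block[OF pd[unfolded A] A11 A12 A12' A22]
  define S T V W Q where defs: "S = pd_sqrt A11" "T = pd_inv_sqrt A11" "V = pd_sqrt A22" "W = pd_inv_sqrt A22"
    "Q = mat_adjoint R"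
  note S = pd_sqrt[OF pd_blocks(1) A11, folded defs] and T = pd_inv_sqrt[OF pd_blocks(1) A11, folded defs]
  note V = pd_sqrt[OF pd_blocks(2) A22, folded defs] and W = pd_inv_sqrt[OF pd_blocks(2) A22, folded defs]
  have TA: "T * A12 \<in> carrier_mat n q" by (rule mult_carrier_mat[OF T(1) A12])
  have R: "R \<in> carrier_mat n q" unfolding R_def defs(1-4)[symmetric] by (rule mult_carrier_mat[OF TA W(1)])
  have Q: "Q \<in> carrier_mat q n" unfolding defs by (rule mat_adjoint_carrier[OF R])
  have adjS: "mat_adjoint S = S" "mat_adjoint V = V" using S(2) V(2) by (auto simp: pos_def_mat_def hermitian_mat_def)
  have A12W: "A12 * W = S * R"
    unfolding R_def defs(1-4)[symmetric] assoc_mult_mat[OF T(1) A12 W(1)]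
    using mult_mat_inverse_cancel[OF T(3) S(1) T(1) mult_carrier_mat[OF A12 W(1)]] by simp
  \<comment> \<open>Factor \<open>A12\<close> as \<open>S * R * V\<close>; the adjoint then factors
    the lower-left block as \<open>V * (Q * S)\<close>, since \<open>S\<close> and \<open>V\<close>
    are self-adjoint.\<close>
  have "A12 = A12 * W * V"
    using assoc_mult_mat[OF A12 W(1) V(1)] W(4) A12 by simp
  also have "\<dots> = S * R * V" unfolding A12W ..
  finally have "mat_adjoint A12 = V * (Q * S)"
    using mat_adjoint_mult[OF mult_carrier_mat[OF S(1) R] V(1)] mat_adjoint_mult[OF S(1) R]
    by (simp add: adjS defs(5))
  then have A21T: "mat_adjoint A12 * T = V * Q"
    using assoc_mult_mat[OF V(1) mult_carrier_mat[OF Q S(1)] T(1)] assoc_mult_mat[OF Q S(1) T(1)] T(3) Q by simp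
  have A11T: "A11 * T = S"
    using assoc_mult_mat[OF S(1) S(1) T(1)] S(1,3) T(3) by simp
  have A22W: "A22 * W = V"
    using assoc_mult_mat[OF V(1) V(1) W(1)] V(1,3) W(3) by simp
  interpret B: whitened_blocks n q A11 A12 "mat_adjoint A12" A22 S T V W R Q
    by unfold_locales (fact A11 A12 A12' A22 S(1) T(1) V(1) W(1) R Q A11T A12W A21T A22W T(3,4) W(3,4))+
  show pdF: "pos_def_mat (1\<^sub>m q - mat_adjoint R * R)"
    using B.pos_def_schur_complement[OF pd[unfolded A] T(2) W(2) defs(5)] unfolding defs(5) .
  have F: "1\<^sub>m q - Q * R \<in> carrier_mat q q" by (rule minus_carrier_mat[OF mult_carrier_mat[OF Q R]])
  define Y where "Y = mat_inv (1\<^sub>m q - Q * R)"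
  note Y = mat_inv_invertible[OF F pos_def_mat_mult_vec_inj[OF pdF[folded defs(5)] F], folded Y_def]
  define X where "X = 1\<^sub>m n + R * (Y * Q)"
  have X: "X \<in> carrier_mat n n"
    unfolding X_def by (rule add_carrier_mat[OF mult_carrier_mat[OF R mult_carrier_mat[OF Y(1) Q]]])
  have FX: "(1\<^sub>m n - R * Q) * X = 1\<^sub>m n"
    unfolding X_def by (rule resolvent_swap[OF Q R Y(1,2)])
  define B11 B12 B21 B22 where B: "B11 = T * (X * T)" "B12 = - (T * (R * (Y * W)))"
    "B21 = - (W * (Q * (X * T)))" "B22 = W * (Y * W)"
  have XT: "X * T \<in> carrier_mat n n" by (rule mult_carrier_mat[OF X T(1)])
  have YW: "Y * W \<in> carrier_mat q q" by (rule mult_carrier_mat[OF Y(1) W(1)])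
  have B11: "B11 \<in> carrier_mat n n" unfolding B by (rule mult_carrier_mat[OF T(1) XT])
  have B22: "B22 \<in> carrier_mat q q" unfolding B by (rule mult_carrier_mat[OF W(1) YW])
  have "A * four_block_mat B11 B12 B21 B22 = 1\<^sub>m (n + q)"
    unfolding A B by (rule B.inverse_blocks[OF X FX Y(1,2)])
  then have inv: "mat_inv A = four_block_mat B11 B12 B21 B22"
    using four_block_carrier_mat[OF A11 A22] four_block_carrier_mat[OF B11 B22]
    unfolding A by (intro mat_inv_eqI)
  have ul: "upper_left n (four_block_mat C11 C12 C21 C22) = C11" if "C11 \<in> carrier_mat n n" "C22 \<in> carrier_mat q q"
    for C11 C12 C21 C22 :: "complex mat"
    using that by (intro eq_matI) (auto simp: upper_left_def)
  have lr: "lower_right q (mat_inv A) = B22"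
    unfolding inv using B11 B22 by (intro eq_matI) (auto simp: lower_right_def)
  have ulA: "upper_left n A = A11" unfolding A by (rule ul[OF A11 A22])
  have ulI: "upper_left n (mat_inv A) = B11" unfolding inv by (rule ul[OF B11 B22])
  have "upper_left n A * upper_left n (mat_inv A) = S * X * T"
    unfolding ulA ulI
    using mult_mat_assoc_eq[OF A11T A11 T(1) XT] assoc_mult_mat[OF S(1) X T(1)] by (simp add: B)
  then have "similar_mat (upper_left n A * upper_left n (mat_inv A)) X"
    using S(1) X T(1,3,4) mult_carrier_mat[OF mult_carrier_mat[OF S(1) X] T(1)]
    by (intro similar_matI[of _ _ S T n]) auto
  moreover have "hermitian_mat (R * Q)"
    using hermitian_gram[OF Q] unfolding defs(5) mat_adjoint_adjoint .
  ultimately show "eigenvalues_mset (upper_left n A * upper_left n (mat_inv A)) =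
      image_mset (\<lambda>z. 1 / (1 - z)) (eigenvalues_mset (R * mat_adjoint R))"
    unfolding defs(5)[symmetric]
    using eigenvalues_mset_similar eigenvalues_mset_resolvent[OF mult_carrier_mat[OF R Q] _ X FX] by metis
  have "A22 * lower_right q (mat_inv A) = V * Y * W"
    unfolding lr using mult_mat_assoc_eq[OF A22W A22 W(1) YW] assoc_mult_mat[OF V(1) Y(1) W(1)] by (simp add: B)
  then have "similar_mat (A22 * lower_right q (mat_inv A)) Y"
    using V(1) Y(1) W(1,3,4) mult_carrier_mat[OF mult_carrier_mat[OF V(1) Y(1)] W(1)]
    by (intro similar_matI[of _ _ V W q]) auto
  moreover have "hermitian_mat (Q * R)"
    using hermitian_gram[OF R] unfolding defs(5) .
  ultimately show "eigenvalues_mset (A22 * lower_right q (mat_inv A)) =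
      image_mset (\<lambda>z. 1 / (1 - z)) (eigenvalues_mset (mat_adjoint R * R))"
    unfolding defs(5)[symmetric]
    using eigenvalues_mset_similar eigenvalues_mset_resolvent[OF mult_carrier_mat[OF Q R] _ Y(1,2)] by metis
qed

theorem mainTheorem3:
  fixes n N q r :: nat
    and A A11 A12 A22 R P :: "complex mat"
  assumes "1 \<le> n" and "n \<le> N"
    and "q = N - n" and "r = min n q"
    and "A \<in> carrier_mat N N" and "pos_def_mat A"
    and "A11 \<in> carrier_mat n n" and "A12 \<in> carrier_mat n q" and "A22 \<in> carrier_mat q q"
    and "A = four_block_mat A11 A12 (mat_adjoint A12) A22"
    and "R = pd_inv_sqrt A11 * A12 * pd_inv_sqrt A22"
    and "P = upper_left n A * upper_left n (mat_inv A)"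
  shows "(int (n - r) = max (2 * int n - int N) 0 \<and>
          n - r \<le> count (eigenvalues_mset P) 1) \<and>
         ((\<forall>i\<in>{1..r}. singular_value R i < 1) \<and>
          eigenvalues_mset P - replicate_mset (n - r) 1 =
            {# complex_of_real (1 / (1 - (singular_value R i)\<^sup>2)). i \<in># mset_set {1..r} #}) \<and>
         {# x \<in># eigenvalues_mset P. x \<noteq> 1 #} =
           {# x \<in># eigenvalues_mset (A22 * lower_right q (mat_inv A)). x \<noteq> 1 #} \<and>
         (full_rank R \<longrightarrow>
           int (count (eigenvalues_mset P) 1) = max (2 * int n - int N) 0)"
proof -
  note n_le_N = assms(2) and q_def = assms(3) and r_def = assms(4) and pd = assms(6)
    and A11 = assms(7) and A12 = assms(8) and A22 = assms(9) and A = assms(10)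
    and R_def = assms(11) and P_def = assms(12)
  \<comment> \<open>This map sends 0, and no other number, to 1. Hence the zeros by which the two
    Gram spectra differ become the extra eigenvalues one.\<close>
  let ?f = "\<lambda>z :: complex. 1 / (1 - z)"
  note blocks = pos_def_mat_four_block[OF pd[unfolded A] A11 A12 mat_adjoint_carrier[OF A12] A22]
  have R: "R \<in> carrier_mat n q"
    unfolding R_def
    by (rule mult_carrier_mat[OF mult_carrier_mat[OF pd_inv_sqrt(1)[OF blocks(1) A11] A12] pd_inv_sqrt(1)[OF blocks(2) A22]])
  note R' = mat_adjoint_carrier[OF R]
  note evs = upper_left_eigenvalues[OF pd A11 A12 A22 A R_def, folded P_def]
  define E where "E = eigenvalues_mset (R * mat_adjoint R)"
  obtain D where D: "eigenvalues_mset (mat_adjoint R * R) = image_mset complex_of_real D"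
    and D_bounds: "\<And>x. x \<in># D \<Longrightarrow> 0 \<le> x \<and> x < 1"
    using eigenvalues_mset_gram[OF R evs(1)] by blast
  have size_E: "size E = n"
    unfolding E_def by (rule size_eigenvalues_mset[OF mult_carrier_mat[OF R R']])
  have size_D: "size D = q"
    using size_eigenvalues_mset[OF mult_carrier_mat[OF R' R]] unfolding D by simp
  have E_D: "E + replicate_mset q 0 = image_mset complex_of_real D + replicate_mset n 0"
    unfolding E_def D[symmetric] by (rule eigenvalues_mset_mult_commute[OF R R'])
  \<comment> \<open>The list inside \<open>singular_value\<close>: all q eigenvalues in descending
    order, of which only the first r concern \<open>E\<close>.\<close>
  define L where "L = rev (sorted_list_of_multiset D)"
  have L: "mset L = D" "length L = q"
    unfolding L_def using size_D by (simp_all flip: size_mset)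
  have E_L: "E = image_mset complex_of_real (mset (take r L)) + replicate_mset (n - r) 0"
    unfolding L_def r_def using multiset_largest_of_padded[OF E_D size_E size_D] D_bounds by blast
  have sv: "singular_value R i = sqrt (L ! (i - 1))" for i
    unfolding singular_value_def D L_def by (simp add: multiset.map_comp comp_def)
  have L_bounds: "0 \<le> L ! (i - 1) \<and> L ! (i - 1) < 1" if "i \<in> {1..r}" for i
  proof -
    have "i - 1 < length L" using that L(2) r_def by auto
    then have "L ! (i - 1) \<in># D" unfolding L(1)[symmetric] by simp
    then show ?thesis by (rule D_bounds)
  qed
  have evs_P: "eigenvalues_mset P = image_mset ?f E"
    using evs(2) unfolding E_def .
  have evs_P_split: "eigenvalues_mset P =
      image_mset (\<lambda>i. complex_of_real (1 / (1 - (singular_value R i)\<^sup>2))) (mset_set {1..r}) + replicate_mset (n - r) 1"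
  proof -
    have "mset (take r L) = image_mset (\<lambda>i. L ! (i - 1)) (mset_set {1..r})"
      by (rule mset_take_conv_image) (simp add: L(2) r_def)
    then have "eigenvalues_mset P =
        image_mset (\<lambda>i. ?f (complex_of_real (L ! (i - 1)))) (mset_set {1..r}) + replicate_mset (n - r) 1"
      unfolding evs_P E_L by (simp add: multiset.map_comp comp_def)
    moreover have "image_mset (\<lambda>i. ?f (complex_of_real (L ! (i - 1)))) (mset_set {1..r}) =
        image_mset (\<lambda>i. complex_of_real (1 / (1 - (singular_value R i)\<^sup>2))) (mset_set {1..r})"
      \<comment> \<open>The entries are nonnegative, so squaring undoes the square root.\<close>
      by (rule image_mset_cong) (use L_bounds in \<open>simp add: sv\<close>)
    ultimately show ?thesis by simp
  qed
  \<comment> \<open>Truncated subtraction supplies the positive part; n \<le> N makes q = N - n an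
    exact difference.\<close>
  have excess: "int (n - r) = max (2 * int n - int N) 0"
    using n_le_N unfolding q_def r_def by auto
  have no_ones: "{# x \<in># replicate_mset k (1 :: complex). x \<noteq> 1 #} = {#}" for k
    by (induction k) auto
  have "\<forall>i\<in>{1..r}. singular_value R i < 1"
    using L_bounds by (simp add: sv)
  moreover have "{# x \<in># eigenvalues_mset P. x \<noteq> 1 #} =
      {# x \<in># eigenvalues_mset (A22 * lower_right q (mat_inv A)). x \<noteq> 1 #}"
    \<comment> \<open>Both paddings in \<open>E_D\<close> are mapped to ones, so the filter removes
      them.\<close>
    using arg_cong[OF E_D, of "\<lambda>M. {# x \<in># image_mset ?f M. x \<noteq> 1 #}"]
    unfolding evs_P evs(3) D by (simp add: no_ones)
  moreover have "int (count (eigenvalues_mset P) 1) = max (2 * int n - int N) 0" if "full_rank R"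
  proof -
    \<comment> \<open>At z = 1 the convention 1 / 0 = 0 applies, so this point does not enter the
      preimage.\<close>
    have "?f -` {1} = {0}"
      by (auto simp: divide_eq_eq split: if_splits)
    then have "count (eigenvalues_mset P) 1 = count E 0"
      unfolding evs_P count_image_mset
      by (cases "0 \<in># E") (auto simp: not_in_iff)
    also have "\<dots> = n - r"
      unfolding E_def r_def by (rule full_rank_count_zero[OF R that])
    finally show ?thesis using excess by simp
  qed
  ultimately show ?thesis
    using excess unfolding evs_P_split by simp
qed

end
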